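(* Let $(W,S)$ be a Coxeter system and let $x,y\in W$ with $x<y$ in the Bruhat order. Then $d_{x,y}\le g_{x,y}$, where $d_{x,y}$ is the negative of the coefficient of $q^{\ell(y)-\ell(x)-1}$ in the $R$-polynomial $R_{x,y}(q)$ and $g_{x,y}$ is the minimal cardinality of a diamond generating subset of the set $E_{x,y}$ of edges of the Bruhat graph restricted to $[x,y]$.
   Context: Let $(W,S)$ be a Coxeter system; $\ell$ is the length function, $\le$ the Bruhat order, $T=\bigcup_{w\in W}wSw^{-1}$ the set of reflections, and $[x,y]=\{z\in W: x\le z\le y\}$. $R$-polynomials: the unique family $\{R_{x,y}(q)\}_{x,y\in W}\subset\mathbb{Z}[q]$ with $R_{x,x}=1$, $R_{x,y}=0$ if $x\not\le y$, and for every $s\in S$ with $ys<y$: $R_{x,y}=R_{xs,ys}$ if $xs<x$, and $R_{x,y}=qR_{xs,ys}+(q-1)R_{x,ys}$ if $xs>x$. For $x\le y$, $R_{x,y}$ is monic of degree $\ell(y)-\ell(x)$, and $d_{x,y}\in\mathbb{Z}$ is defined by $R_{x,y}(q)=q^{\ell(y)-\ell(x)}-d_{x,y}q^{\ell(y)-\ell(x)-1}+(\text{lower terms in } q)$. Diamonds: let $\mathcal{G}|_{[x,y]}$ be the undirected graph with vertex set $[x,y]$ in which $z$ and $w$ are joined by an edge $(z - w)$ iff $w=zt$ for some $t\in T$ (no condition on the length difference). Let $E_{x,y}$ be its set of edges. A diamond is a $4$-cycle in $\mathcal{G}|_{[x,y]}$, consisting of four edges between four different vertices. A subset $F\subseteq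 E_{x,y}$ is diamond closed if, whenever two adjacent edges (i.e. two edges sharing a vertex) of a diamond lie in $F$, the other two edges of this diamond also lie in $F$. The diamond closure $F^\diamond$ is the smallest diamond closed subset of $E_{x,y}$ containing $F$. $F$ is diamond generating if $F^\diamond=E_{x,y}$. Finally $g_{x,y}:=\min\{|F| : F\subseteq E_{x,y}\text{ diamond generating}\}$. *)

theory Defs
  imports "HOL-Algebra.Multiplicative_Group" "HOL-Algebra.Generated_Groups"
    "HOL-Computational_Algebra.Polynomial"
begin

section \<open>Coxeter systems\<close>

definition word_prod :: "('a, 'b) monoid_scheme \<Rightarrow> 'a list \<Rightarrow> 'a" where
  "word_prod W ws = foldr (\<otimes>\<^bsub>W\<^esub>) ws \<one>\<^bsub>W\<^esub>"

text \<open>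
  Deletion of one factor \<open>(s t)\<^sup>m\<close> from a word over \<open>S\<close>, where \<open>m\<close> is the order of \<open>s t\<close>.
  If \<open>s t\<close> has infinite order, the library sets its order to 0 and nothing is deleted, so no
  relation is imposed.  The case \<open>s = t\<close> (with \<open>m = 1\<close>) is the relation \<open>s\<^sup>2 = 1\<close>; it makes every
  letter its own inverse, so words over \<open>S\<close> without formal inverses suffice.
\<close>

definition coxeter_deletion ::
  "('a, 'b) monoid_scheme \<Rightarrow> 'a set \<Rightarrow> 'a list \<Rightarrow> 'a list \<Rightarrow> bool" where
  "coxeter_deletion W S ws ws' \<longleftrightarrow>
     (\<exists>u \<in> lists S. \<exists>v \<in> lists S. \<exists>s \<in> S. \<exists>t \<in> S.
        ws = u @ concat (replicate (group.ord W (s \<otimes>\<^bsub>W\<^esub> t)) [s, t]) @ v \<and> ws' = u @ v)"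

text \<open>
  The last assumption says that the relations \<open>(s t)\<^sup>m = 1\<close>, with \<open>m\<close> the order of \<open>s t\<close>, present
  \<open>W\<close>: every word with value \<open>1\<close> is equivalent to the empty word modulo these relations.  The set
  \<open>S\<close> may be infinite.
\<close>

locale coxeter_system = group W for W (structure) +
  fixes S :: "'a set"
  assumes gens_closed: "S \<subseteq> carrier W"
    and gens_generate: "generate W S = carrier W"
    and gens_order: "\<And>s. s \<in> S \<Longrightarrow> ord s = 2"
    and presentation:
      "\<And>ws. ws \<in> lists S \<Longrightarrow> word_prod W ws = \<one> \<Longrightarrow> equivclp (coxeter_deletion W S) ws []"

definition cox_length :: "('a, 'b) monoid_scheme \<Rightarrow> 'a set \<Rightarrow> 'a \<Rightarrow> nat" where
  "cox_length W S w = (LEAST n. \<exists>ws \<in> lists S. length ws = n \<and> word_prod W ws = w)"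

definition reflections :: "('a, 'b) monoid_scheme \<Rightarrow> 'a set \<Rightarrow> 'a set" where
  "reflections W S = {w \<otimes>\<^bsub>W\<^esub> s \<otimes>\<^bsub>W\<^esub> inv\<^bsub>W\<^esub> w | w s. w \<in> carrier W \<and> s \<in> S}"


section \<open>Bruhat order\<close>

definition bruhat_step :: "('a, 'b) monoid_scheme \<Rightarrow> 'a set \<Rightarrow> 'a \<Rightarrow> 'a \<Rightarrow> bool" where
  "bruhat_step W S x y \<longleftrightarrow>
     x \<in> carrier W \<and> (\<exists>t \<in> reflections W S. y = x \<otimes>\<^bsub>W\<^esub> t) \<and> cox_length W S x < cox_length W S y"

definition bruhat_le :: "('a, 'b) monoid_scheme \<Rightarrow> 'a set \<Rightarrow> 'a \<Rightarrow> 'a \<Rightarrow> bool" where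
  "bruhat_le W S x y \<longleftrightarrow> x \<in> carrier W \<and> y \<in> carrier W \<and> (bruhat_step W S)\<^sup>*\<^sup>* x y"

definition bruhat_less :: "('a, 'b) monoid_scheme \<Rightarrow> 'a set \<Rightarrow> 'a \<Rightarrow> 'a \<Rightarrow> bool" where
  "bruhat_less W S x y \<longleftrightarrow> bruhat_le W S x y \<and> x \<noteq> y"

definition bruhat_interval :: "('a, 'b) monoid_scheme \<Rightarrow> 'a set \<Rightarrow> 'a \<Rightarrow> 'a \<Rightarrow> 'a set" where
  "bruhat_interval W S x y = {z. bruhat_le W S x z \<and> bruhat_le W S z y}"


section \<open>R-polynomials\<close>

text \<open>
  The variable \<open>q\<close> is \<open>[:0, 1:]\<close>.  Since \<open>bruhat_le\<close> fails outside the carrier, the second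
  condition also makes the family zero there, so that it is unique as a total function.
\<close>

definition is_R_family ::
  "('a, 'b) monoid_scheme \<Rightarrow> 'a set \<Rightarrow> ('a \<Rightarrow> 'a \<Rightarrow> int poly) \<Rightarrow> bool" where
  "is_R_family W S R \<longleftrightarrow>
     (\<forall>x \<in> carrier W. R x x = 1) \<and>
     (\<forall>x y. \<not> bruhat_le W S x y \<longrightarrow> R x y = 0) \<and>
     (\<forall>x \<in> carrier W. \<forall>y \<in> carrier W. \<forall>s \<in> S. bruhat_less W S (y \<otimes>\<^bsub>W\<^esub> s) y \<longrightarrow>
        (bruhat_less W S (x \<otimes>\<^bsub>W\<^esub> s) x \<longrightarrow> R x y = R (x \<otimes>\<^bsub>W\<^esub> s) (y \<otimes>\<^bsub>W\<^esub> s)) \<and>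
        (bruhat_less W S x (x \<otimes>\<^bsub>W\<^esub> s) \<longrightarrow>
           R x y = [:0, 1:] * R (x \<otimes>\<^bsub>W\<^esub> s) (y \<otimes>\<^bsub>W\<^esub> s) + ([:0, 1:] - 1) * R x (y \<otimes>\<^bsub>W\<^esub> s)))"

definition R_poly :: "('a, 'b) monoid_scheme \<Rightarrow> 'a set \<Rightarrow> 'a \<Rightarrow> 'a \<Rightarrow> int poly" where
  "R_poly W S = (THE R. is_R_family W S R)"

text \<open>
  The subtraction in the index is on natural numbers, so this is the intended coefficient only
  for \<open>x < y\<close>.  The name \<open>coeff\<close> is qualified because HOL-Algebra has another one.
\<close>

definition d_coeff :: "('a, 'b) monoid_scheme \<Rightarrow> 'a set \<Rightarrow> 'a \<Rightarrow> 'a \<Rightarrow> int" where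
  "d_coeff W S x y =
     - Polynomial.coeff (R_poly W S x y) (cox_length W S y - cox_length W S x - 1)"


section \<open>Diamonds\<close>

definition bruhat_edges :: "('a, 'b) monoid_scheme \<Rightarrow> 'a set \<Rightarrow> 'a \<Rightarrow> 'a \<Rightarrow> 'a set set" where
  "bruhat_edges W S x y =
     {{z, w} | z w. z \<in> bruhat_interval W S x y \<and> w \<in> bruhat_interval W S x y \<and>
                    (\<exists>t \<in> reflections W S. w = z \<otimes>\<^bsub>W\<^esub> t)}"

definition is_diamond :: "'a set set \<Rightarrow> 'a \<Rightarrow> 'a \<Rightarrow> 'a \<Rightarrow> 'a \<Rightarrow> bool" where
  "is_diamond E a b c d \<longleftrightarrow>
     distinct [a, b, c, d] \<and> {a, b} \<in> E \<and> {b, c} \<in> E \<and> {c, d} \<in> E \<and> {d, a} \<in> E"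

text \<open>
  All labellings of a diamond are quantified over, so it is enough to treat the two edges that
  meet in the vertex \<open>b\<close>.
\<close>

definition diamond_closed :: "'a set set \<Rightarrow> 'a set set \<Rightarrow> bool" where
  "diamond_closed E F \<longleftrightarrow> F \<subseteq> E \<and>
     (\<forall>a b c d. is_diamond E a b c d \<and> {a, b} \<in> F \<and> {b, c} \<in> F \<longrightarrow> {c, d} \<in> F \<and> {d, a} \<in> F)"

definition diamond_closure :: "'a set set \<Rightarrow> 'a set set \<Rightarrow> 'a set set" where
  "diamond_closure E F = \<Inter>{G. diamond_closed E G \<and> F \<subseteq> G}"

definition diamond_generating :: "'a set set \<Rightarrow> 'a set set \<Rightarrow> bool" where
  "diamond_generating E F \<longleftrightarrow> F \<subseteq> E \<and> diamond_closure E F = E"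

text \<open>
  Bruhat intervals, hence their edge sets, are finite; the explicit \<open>finite F\<close> only excludes the
  convention that infinite sets have cardinality 0.
\<close>

definition g_min :: "('a, 'b) monoid_scheme \<Rightarrow> 'a set \<Rightarrow> 'a \<Rightarrow> 'a \<Rightarrow> nat" where
  "g_min W S x y =
     (LEAST n. \<exists>F. diamond_generating (bruhat_edges W S x y) F \<and> finite F \<and> card F = n)"

end

theory Submission
  imports Defs "HOL-Analysis.Finite_Function_Topology"
begin

text \<open>
  Consider functions \<open>f\<close> from the interval \<open>[x, y]\<close> to the geometric representation of \<open>W\<close> whose
  difference along every edge \<open>z - r z\<close>, with \<open>r\<close> a reflection, is a multiple of the root of \<open>r\<close>.
  These are the sections of degree one in the roots of the structure sheaf of the Bruhat graph on
  \<open>[x, y]\<close>.  Let \<open>h\<close> be the dimension of the space of these sections modulo constants.  The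
  theorem follows from \<open>d \<le> h\<close> and \<open>h \<le> g\<close>.

  For \<open>h \<le> g\<close>, let \<open>a, b, c, d\<close> be a diamond such that \<open>f\<close> has the same value at \<open>a\<close>, \<open>b\<close> and
  \<open>c\<close>.  Then \<open>f d - f a = f d - f c\<close> is a multiple of the roots of two different reflections, so it
  vanishes.  Hence the edges along which a section is constant form a diamond closed set
  (\<open>constant_edges_diamond_closed\<close>), and a section that is constant along the edges of a diamond
  generating set is constant, because \<open>[x, y]\<close> is connected.  Being constant along one edge is one
  linear condition, so more than \<open>|F|\<close> sections have a nontrivial combination that is constant
  (\<open>independent_sections_le_card\<close>).

  For \<open>d \<le> h\<close>, let \<open>s\<close> be a right descent of \<open>y\<close>.  The recursion of the R-polynomials gives
  \<open>d x y = d (x s) (y s)\<close> if \<open>x s < x\<close>; if \<open>x s > x\<close>, then \<open>d x y\<close> is \<open>d x (y s)\<close>, increased by \<open>1\<close>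
  exactly when \<open>x s\<close> is not below \<open>y s\<close>.  Sections follow this recursion.  Assume \<open>x < x s\<close>.  Then
  \<open>[x, y]\<close> is the union of \<open>[x, y s]\<close> and its translate by \<open>s\<close>.  A section \<open>f\<close> on \<open>[x, y s]\<close> changes
  along all edges \<open>z - z s\<close> by the same multiple \<open>c\<close> of the root \<open>z \<alpha>\<close>, where \<open>\<alpha>\<close> is the simple root
  of \<open>s\<close>; therefore \<open>f + (c / 2) z \<alpha>\<close> is invariant under \<open>s\<close> and extends to \<open>[x, y]\<close> by
  invariance (\<open>section_extend\<close>).  If \<open>x s\<close> is not below \<open>y s\<close>, there are no such edges in
  \<open>[x, y s]\<close>, the multiple \<open>c\<close> is free, and one new section appears.  The case \<open>x s < x\<close> is covered
  by extending from \<open>[x s, y s]\<close> to \<open>[x s, y]\<close> and restricting to \<open>[x, y]\<close>.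

  Two ingredients make this rigorous.  The geometric representation has to be faithful enough to
  distinguish the roots of different reflections; this and the strong exchange condition come from
  Tits' theorem that a root is either positive or negative (\<open>act_simple_root_nonneg\<close>).  And the
  R-polynomials have to exist; they are the coefficients of products of inverse generators in
  the Hecke algebra (\<open>fold_bar_reduced_unique\<close>).
\<close>

section \<open>Words and lengths\<close>

text \<open>
  The letters are counted from the right because the last letter of a reduced word is a right
  descent.
\<close>
fun altw :: "'a \<Rightarrow> 'a \<Rightarrow> nat \<Rightarrow> 'a list" where
  "altw s t 0 = []"
| "altw s t (Suc k) = altw t s k @ [t]"

lemma length_altw [simp]: "length (altw s t k) = k"
  by (induction k arbitrary: s t) auto

lemma altw_in_lists: "s \<in> A \<Longrightarrow> t \<in> A \<Longrightarrow> altw s t k \<in> lists A"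
  by (induction k arbitrary: s t) auto

lemma altw_Suc_Cons: "altw s t (Suc k) = (if even k then t else s) # altw s t k"
proof (induction k arbitrary: s t)
  case (Suc k)
  have "altw s t (Suc (Suc k)) = altw t s (Suc k) @ [t]" by simp
  also have "\<dots> = (if even k then s else t) # altw t s k @ [t]"
    by (simp only: Suc.IH append_Cons)
  also have "\<dots> = (if even (Suc k) then t else s) # altw s t (Suc k)" by simp
  finally show ?case .
qed simp

lemma altw_add: "\<exists>ws. altw s t (k + n) = ws @ altw s t n \<and> set ws \<subseteq> {s, t}"
proof (induction k)
  case (Suc k)
  then obtain ws where "altw s t (k + n) = ws @ altw s t n" "set ws \<subseteq> {s, t}" by blast
  then have "altw s t (Suc k + n) = ((if even (k + n) then t else s) # ws) @ altw s t n"
    by (simp only: add_Suc altw_Suc_Cons append_Cons)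
  moreover have "set ((if even (k + n) then t else s) # ws) \<subseteq> {s, t}"
    using \<open>set ws \<subseteq> {s, t}\<close> by auto
  ultimately show ?case by blast
qed auto

lemma concat_replicate_altw: "concat (replicate m [s, t]) = altw s t (2 * m)"
proof (induction m)
  case (Suc m)
  have "altw s t (2 * Suc m) = altw s t (Suc (Suc (2 * m)))" by simp
  also have "\<dots> = s # t # altw s t (2 * m)" by (simp only: altw_Suc_Cons) simp
  finally show ?case using Suc by simp
qed simp

lemma alternating_word:
  assumes "set us \<subseteq> {s, t}" "us \<noteq> []" "last us = t" "s \<noteq> t"
    and "\<And>as c bs. us \<noteq> as @ c # c # bs"
  shows "us = altw s t (length us)"
  using assms
proof (induction us arbitrary: s t rule: rev_induct)
  case (snoc c us)
  have c: "c = t" using snoc.prems by simp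
  show ?case
  proof (cases "us = []")
    case False
    have "last us \<noteq> t"
    proof
      assume "last us = t"
      then have "us @ [c] = butlast us @ t # t # []"
        using False c by (metis append_butlast_last_id append.assoc append_Cons append_Nil)
      with snoc.prems(5) show False by blast
    qed
    moreover have "set us \<subseteq> {s, t}" using snoc.prems(1) by simp
    ultimately have "last us = s" using last_in_set[OF False] by blast
    moreover have "us \<noteq> as @ d # d # bs" for as d bs
      using snoc.prems(5)[of as d "bs @ [c]"] by auto
    ultimately have "us = altw t s (length us)"
      using snoc.prems(1,4) False by (intro snoc.IH) auto
    then show ?thesis using c by simp
  qed (simp add: c)
qed simp

context coxeter_system
begin

declare in_lists_conv_set [simp del]

lemma rev_in_lists [simp]: "rev ws \<in> lists A \<longleftrightarrow> ws \<in> lists A"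
  by (simp add: in_lists_conv_set)

abbreviation wprod :: "'a list \<Rightarrow> 'a" where "wprod \<equiv> word_prod W"

abbreviation len :: "'a \<Rightarrow> nat" where "len \<equiv> cox_length W S"

lemma S_carrier [simp, intro]: "s \<in> S \<Longrightarrow> s \<in> carrier W"
  using gens_closed by blast

lemma wprod_Nil [simp]: "wprod [] = \<one>"
  by (simp add: word_prod_def)

lemma wprod_Cons [simp]: "wprod (s # ws) = s \<otimes> wprod ws"
  by (simp add: word_prod_def)

lemma wprod_closed [simp, intro]: "ws \<in> lists S \<Longrightarrow> wprod ws \<in> carrier W"
  by (induction ws) auto

lemma wprod_append: "us \<in> lists S \<Longrightarrow> vs \<in> lists S \<Longrightarrow> wprod (us @ vs) = wprod us \<otimes> wprod vs"
  by (induction us) (auto simp: m_assoc)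

lemma gen_square [simp]: "s \<in> S \<Longrightarrow> s \<otimes> s = \<one>"
  using gens_order[of s] pow_ord_eq_1[of s] by (simp add: numeral_2_eq_2)

lemma gen_inv [simp]: "s \<in> S \<Longrightarrow> inv s = s"
  by (simp add: inv_equality)

lemma gen_cancel [simp]:
  assumes "s \<in> S" "w \<in> carrier W"
  shows "w \<otimes> s \<otimes> s = w" and "s \<otimes> (s \<otimes> w) = w"
  using assms by (simp_all add: m_assoc flip: m_assoc[of s s w])

lemma wprod_rev: "ws \<in> lists S \<Longrightarrow> wprod (rev ws) = inv (wprod ws)"
  by (induction ws) (auto simp: wprod_append inv_mult_group)

lemma ex_word:
  assumes "w \<in> carrier W"
  shows "\<exists>ws \<in> lists S. wprod ws = w"
proof -
  have "w \<in> generate W S" using assms gens_generate by simp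
  then show ?thesis
  proof (induction rule: generate.induct)
    case one
    show ?case by (rule bexI[of _ "[]"]) auto
  next
    case (incl h)
    then show ?case by (intro bexI[of _ "[h]"]) auto
  next
    case (inv h)
    then show ?case by (intro bexI[of _ "[h]"]) auto
  next
    case (eng h1 h2)
    then show ?case by (metis wprod_append append_in_lists_conv)
  qed
qed

text \<open>
  All uses of the presentation go through this lemma: whatever does not notice the deletion of a
  relator cannot distinguish a word of value \<open>\<one>\<close> from the empty word.
\<close>
lemma word_relation_invariant:
  assumes step: "\<And>us vs. coxeter_deletion W S us vs \<Longrightarrow> f us = f vs"
    and "us \<in> lists S" "wprod us = \<one>"
  shows "f us = f []"
proof -
  have "equivclp (coxeter_deletion W S) us []" using presentation assms(2,3) .
  then show ?thesis
    by (induction rule: equivclp_induct) (auto dest: step)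
qed

lemma ex_reduced:
  assumes "w \<in> carrier W"
  obtains ws where "ws \<in> lists S" "wprod ws = w" "length ws = len w"
proof -
  have "\<exists>n. \<exists>ws \<in> lists S. length ws = n \<and> wprod ws = w" using ex_word[OF assms] by blast
  from LeastI_ex[OF this] show thesis using that unfolding cox_length_def by blast
qed

lemma len_le: "ws \<in> lists S \<Longrightarrow> len (wprod ws) \<le> length ws"
  unfolding cox_length_def by (rule Least_le) blast

lemma len_one [simp]: "len \<one> = 0"
  using len_le[of "[]"] by simp

lemma parity_word:
  assumes "us \<in> lists S" "vs \<in> lists S" "wprod us = wprod vs"
  shows "even (length us) = even (length vs)"
proof -
  have "even (length (us @ rev vs)) = even (length ([] :: 'a list))"
  proof (rule word_relation_invariant)
    show "us @ rev vs \<in> lists S" using assms by auto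
    show "wprod (us @ rev vs) = \<one>" using assms by (auto simp: wprod_append wprod_rev)
    fix as bs assume "coxeter_deletion W S as bs"
    then show "even (length as) = even (length bs)"
      unfolding coxeter_deletion_def concat_replicate_altw by auto
  qed
  then show ?thesis by simp
qed

lemma parity_len: "ws \<in> lists S \<Longrightarrow> even (len (wprod ws)) = even (length ws)"
  by (metis ex_reduced parity_word wprod_closed)

lemma len_mult_gen_le:
  assumes "w \<in> carrier W" "s \<in> S"
  shows "len (w \<otimes> s) \<le> Suc (len w)" "len (s \<otimes> w) \<le> Suc (len w)"
proof -
  obtain ws where ws: "ws \<in> lists S" "wprod ws = w" "length ws = len w"
    using ex_reduced[OF assms(1)] .
  show "len (w \<otimes> s) \<le> Suc (len w)"
    using len_le[of "ws @ [s]"] ws assms by (simp add: wprod_append)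
  show "len (s \<otimes> w) \<le> Suc (len w)"
    using len_le[of "s # ws"] ws assms by simp
qed

lemma len_gen_parity:
  assumes "w \<in> carrier W" "s \<in> S"
  shows "even (len (w \<otimes> s)) \<longleftrightarrow> odd (len w)" "even (len (s \<otimes> w)) \<longleftrightarrow> odd (len w)"
proof -
  obtain ws where ws: "ws \<in> lists S" "wprod ws = w" "length ws = len w"
    using ex_reduced[OF assms(1)] .
  show "even (len (w \<otimes> s)) \<longleftrightarrow> odd (len w)"
    using parity_len[of "ws @ [s]"] ws assms by (simp add: wprod_append)
  show "even (len (s \<otimes> w)) \<longleftrightarrow> odd (len w)"
    using parity_len[of "s # ws"] ws assms by simp
qed

lemma len_right_cases:
  assumes "w \<in> carrier W" "s \<in> S"
  obtains "len (w \<otimes> s) = Suc (len w)" | "len w = Suc (len (w \<otimes> s))"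
proof -
  have "len w \<le> Suc (len (w \<otimes> s))"
    using len_mult_gen_le(1)[of "w \<otimes> s" s] assms by simp
  moreover have "len w \<noteq> len (w \<otimes> s)" using len_gen_parity[OF assms] by metis
  ultimately show thesis using len_mult_gen_le(1)[OF assms] that by linarith
qed

lemma len_left_cases:
  assumes "w \<in> carrier W" "s \<in> S"
  obtains "len (s \<otimes> w) = Suc (len w)" | "len w = Suc (len (s \<otimes> w))"
proof -
  have "len w \<le> Suc (len (s \<otimes> w))"
    using len_mult_gen_le(2)[of "s \<otimes> w" s] assms by simp
  moreover have "len w \<noteq> len (s \<otimes> w)" using len_gen_parity[OF assms] by metis
  ultimately show thesis using len_mult_gen_le(2)[OF assms] that by linarith
qed

lemma len_inv: 
  assumes "w \<in> carrier W" shows "len (inv w) = len w"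
proof -
  have le: "len (inv v) \<le> len v" if "v \<in> carrier W" for v
  proof -
    obtain ws where ws: "ws \<in> lists S" "wprod ws = v" "length ws = len v"
      using ex_reduced[OF \<open>v \<in> carrier W\<close>] .
    then show ?thesis using len_le[of "rev ws"] by (simp add: wprod_rev)
  qed
  show ?thesis using le[of w] le[of "inv w"] assms by simp
qed

lemma ex_right_descent:
  assumes "w \<in> carrier W" "w \<noteq> \<one>"
  obtains s where "s \<in> S" "len w = Suc (len (w \<otimes> s))"
proof -
  obtain ws where ws: "ws \<in> lists S" "wprod ws = w" "length ws = len w"
    using ex_reduced[OF assms(1)] .
  then have "ws \<noteq> []" using assms by auto
  then obtain us s where us: "ws = us @ [s]" by (metis rev_exhaust)
  have s: "s \<in> S" "us \<in> lists S" using ws us by auto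
  then have "w \<otimes> s = wprod us" using ws(2) us by (simp add: wprod_append m_assoc flip: ws(2))
  then have "len (w \<otimes> s) < len w" using len_le[of us] s ws us by simp
  then show thesis using that[OF s(1)] len_right_cases[OF assms(1) s(1)] by (metis not_less_iff_gr_or_eq lessI)
qed

text \<open>
  Enlarging \<open>k\<close> multiplies the quotient of the two alternating words by one generator on each side.
\<close>
lemma braid_quotient:
  assumes "s \<in> S" "t \<in> S"
  shows "wprod (altw s t k) \<otimes> inv (wprod (altw t s k)) =
    (if even k then (s \<otimes> t) [^] k else (t \<otimes> s) [^] k)"
proof (induction k)
  case (Suc k)
  let ?x = "if even k then t else s" and ?y = "if even k then s else t"
  have cl: "wprod (altw s t k) \<in> carrier W" "wprod (altw t s k) \<in> carrier W"
    using altw_in_lists assms wprod_closed by metis+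
  have 1: "wprod (altw s t (Suc k)) = ?x \<otimes> wprod (altw s t k)"
    by (simp only: altw_Suc_Cons wprod_Cons)
  have 2: "wprod (altw t s (Suc k)) = ?y \<otimes> wprod (altw t s k)"
    by (simp only: altw_Suc_Cons wprod_Cons)
  have "wprod (altw s t (Suc k)) \<otimes> inv (wprod (altw t s (Suc k))) =
      ?x \<otimes> (wprod (altw s t k) \<otimes> inv (wprod (altw t s k))) \<otimes> ?y"
    unfolding 1 2 using assms cl by (auto simp: inv_mult_group m_assoc)
  also have "\<dots> = (if even (Suc k) then (s \<otimes> t) [^] Suc k else (t \<otimes> s) [^] Suc k)"
  proof -
    have shift: "x \<otimes> (y \<otimes> x) [^] n = (x \<otimes> y) [^] n \<otimes> x"
      if "x \<in> carrier W" "y \<in> carrier W" for x y and n :: nat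
    proof (induction n)
      case (Suc n)
      then show ?case using that by (simp add: m_assoc[symmetric])
    qed (use that in simp)
    show ?thesis
      unfolding Suc.IH using assms by (simp add: shift) (simp add: m_assoc)
  qed
  finally show ?case .
qed simp

lemma braid_relation:
  assumes "s \<in> S" "t \<in> S"
  shows "wprod (altw s t (ord (s \<otimes> t))) = wprod (altw t s (ord (s \<otimes> t)))"
proof -
  let ?m = "ord (s \<otimes> t)"
  have cl: "wprod (altw s t ?m) \<in> carrier W" "wprod (altw t s ?m) \<in> carrier W"
    using altw_in_lists assms wprod_closed by metis+
  have st: "(s \<otimes> t) [^] ?m = \<one>" using assms by simp
  have "t \<otimes> s = inv (s \<otimes> t)" using assms by (simp add: inv_mult_group)
  then have "(t \<otimes> s) [^] ?m = \<one>" using st assms by (simp add: nat_pow_inv)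
  then have "wprod (altw s t ?m) \<otimes> inv (wprod (altw t s ?m)) = \<one>"
    using braid_quotient[OF assms] st by presburger
  then show ?thesis using cl by (metis inv_closed inv_inv inv_equality)
qed

lemma ord_swap: "s \<in> S \<Longrightarrow> t \<in> S \<Longrightarrow> ord (t \<otimes> s) = ord (s \<otimes> t)"
  using ord_inv[of "s \<otimes> t"] by (simp add: inv_mult_group)

end

section \<open>The geometric representation\<close>

definition simple_root :: "'a \<Rightarrow> 'a \<Rightarrow>\<^sub>0 real" where
  "simple_root s = Poly_Mapping.single s 1"

abbreviation vcoeff :: "('a \<Rightarrow>\<^sub>0 real) \<Rightarrow> 'a \<Rightarrow> real" where
  "vcoeff \<equiv> Poly_Mapping.lookup"

lemma vcoeff_scaleR [simp]: "vcoeff (c *\<^sub>R v) s = c * vcoeff v s"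
proof -
  have "finite {x. c * vcoeff v x \<noteq> 0}"
    by (rule finite_subset[OF _ Poly_Mapping.finite_keys[of v]]) (auto simp: in_keys_iff)
  then show ?thesis by (simp add: scaleR_poly_mapping_def)
qed

lemma vcoeff_simple_root: "vcoeff (simple_root s) t = (if s = t then 1 else 0)"
  by (simp add: simple_root_def lookup_single when_def)

lemma simple_root_nonzero [simp]: "simple_root s \<noteq> 0"
  by (metis vcoeff_simple_root lookup_zero zero_neq_one)

text \<open>
  These are the Chebyshev polynomials of the second kind with shifted index and \<open>\<kappa>\<close> for \<open>2 cos \<theta>\<close>,
  where they take the value \<open>sin (k \<theta>) / sin \<theta>\<close>.
\<close>
fun cheb :: "real \<Rightarrow> nat \<Rightarrow> real" where
  "cheb \<kappa> 0 = 0"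
| "cheb \<kappa> (Suc 0) = 1"
| "cheb \<kappa> (Suc (Suc k)) = \<kappa> * cheb \<kappa> (Suc k) - cheb \<kappa> k"

lemma cheb_sin: "cheb (2 * cos \<theta>) k * sin \<theta> = sin (real k * \<theta>)"
proof (induction "2 * cos \<theta>" k rule: cheb.induct)
  case (3 k)
  have "sin (real (Suc (Suc k)) * \<theta>) + sin (real k * \<theta>) = 2 * cos \<theta> * sin (real (Suc k) * \<theta>)"
    using sin_add[of "real (Suc k) * \<theta>" \<theta>] sin_diff[of "real (Suc k) * \<theta>" \<theta>]
    by (simp add: algebra_simps)
  then show ?case using 3 by (simp add: algebra_simps)
qed auto

lemma cheb_two: "cheb 2 k = real k"
  by (induction "2 :: real" k rule: cheb.induct) auto

context coxeter_system
begin

text \<open>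
  If \<open>s t\<close> has infinite order, then \<open>ord (s \<otimes> t) = 0\<close>, the quotient is \<open>0\<close>, and the value is \<open>- 1\<close>,
  as it should be.
\<close>
definition bil :: "'a \<Rightarrow> 'a \<Rightarrow> real" where
  "bil s t = - cos (pi / real (ord (s \<otimes> t)))"

definition pairing :: "'a \<Rightarrow> ('a \<Rightarrow>\<^sub>0 real) \<Rightarrow> real" where
  "pairing s v = (\<Sum>t \<in> Poly_Mapping.keys v. vcoeff v t * bil s t)"

definition srefl :: "'a \<Rightarrow> ('a \<Rightarrow>\<^sub>0 real) \<Rightarrow> ('a \<Rightarrow>\<^sub>0 real)" where
  "srefl s v = v - (2 * pairing s v) *\<^sub>R simple_root s"

definition act_word :: "'a list \<Rightarrow> ('a \<Rightarrow>\<^sub>0 real) \<Rightarrow> ('a \<Rightarrow>\<^sub>0 real)" where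
  "act_word ws = foldr srefl ws"

lemma act_word_simps [simp]:
  "act_word [] v = v" "act_word (s # ws) v = srefl s (act_word ws v)"
  "act_word (us @ vs) v = act_word us (act_word vs v)"
  by (simp_all add: act_word_def)

lemma pairing_superset:
  assumes "finite A" "Poly_Mapping.keys v \<subseteq> A"
  shows "pairing s v = (\<Sum>t \<in> A. vcoeff v t * bil s t)"
  unfolding pairing_def
  by (rule sum.mono_neutral_left) (use assms in \<open>auto simp: in_keys_iff\<close>)

lemma linear_pairing: "linear (pairing s)"
proof
  fix u v :: "'a \<Rightarrow>\<^sub>0 real" and c :: real
  let ?A = "Poly_Mapping.keys u \<union> Poly_Mapping.keys v"
  have "Poly_Mapping.keys (u + v) \<subseteq> ?A" by (rule keys_add)
  then have "pairing s (u + v) = (\<Sum>t \<in> ?A. vcoeff (u + v) t * bil s t)"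
    by (intro pairing_superset) auto
  also have "\<dots> = pairing s u + pairing s v"
    by (simp add: pairing_superset[of ?A u] pairing_superset[of ?A v] lookup_add algebra_simps
        sum.distrib)
  finally show "pairing s (u + v) = pairing s u + pairing s v" .
  have "Poly_Mapping.keys (c *\<^sub>R u) \<subseteq> Poly_Mapping.keys u" by (auto simp: in_keys_iff)
  then have "pairing s (c *\<^sub>R u) = (\<Sum>t \<in> Poly_Mapping.keys u. vcoeff (c *\<^sub>R u) t * bil s t)"
    by (intro pairing_superset) auto
  also have "\<dots> = c *\<^sub>R pairing s u"
    by (simp add: pairing_def sum_distrib_left mult.assoc)
  finally show "pairing s (c *\<^sub>R u) = c *\<^sub>R pairing s u" .
qed

lemma pairing_simps [simp]:
  "pairing s (u + v) = pairing s u + pairing s v"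
  "pairing s (u - v) = pairing s u - pairing s v"
  "pairing s (c *\<^sub>R u) = c * pairing s u"
  "pairing s (- u) = - pairing s u"
  "pairing s 0 = 0"
  using linear_pairing[of s]
  by (simp_all add: linear_add linear_diff linear_scale linear_neg linear_0)

lemma pairing_simple_root [simp]: "pairing s (simple_root t) = bil s t"
  by (subst pairing_superset[of "{t}"]) (auto simp: vcoeff_simple_root simple_root_def)

lemma linear_srefl: "linear (srefl s)"
  by (rule linearI) (simp_all add: srefl_def algebra_simps)

lemma linear_act_word: "linear (act_word ws)"
proof (induction ws)
  case Nil
  have "act_word [] = id" by auto
  then show ?case by (simp only: linear_id)
next
  case (Cons s ws)
  have "act_word (s # ws) = srefl s \<circ> act_word ws" by auto
  then show ?case using linear_compose[OF Cons linear_srefl] by (simp only:)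
qed

lemma bil_refl [simp]: "s \<in> S \<Longrightarrow> bil s s = 1"
  by (simp add: bil_def ord_eq_1)

lemma bil_sym: "s \<in> S \<Longrightarrow> t \<in> S \<Longrightarrow> bil t s = bil s t"
  by (simp add: bil_def ord_swap)

lemma srefl_simple_root [simp]: "s \<in> S \<Longrightarrow> srefl s (simple_root s) = - simple_root s"
  by (simp add: srefl_def scaleR_2)

lemma srefl_square [simp]: "s \<in> S \<Longrightarrow> srefl s (srefl s v) = v"
  by (simp add: srefl_def algebra_simps flip: scaleR_add_left)

lemma ord_gens_ge_2:
  assumes "s \<in> S" "t \<in> S" "s \<noteq> t" "ord (s \<otimes> t) \<noteq> 0"
  shows "ord (s \<otimes> t) \<ge> 2"
proof -
  have "ord (s \<otimes> t) \<noteq> 1"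
    using assms ord_eq_1[of "s \<otimes> t"] by (metis gen_inv inv_equality m_closed S_carrier)
  then show ?thesis using assms(4) by linarith
qed

text \<open>
  Each further letter reflects one of the two coordinates of the plane, which is one step of the
  recursion of \<open>cheb\<close>.
\<close>
lemma act_altw_simple_root:
  assumes "s \<in> S" "t \<in> S"
  defines "\<kappa> \<equiv> - 2 * bil s t"
  shows "act_word (altw s t k) (simple_root s) =
    (if even k then cheb \<kappa> (Suc k) *\<^sub>R simple_root s + cheb \<kappa> k *\<^sub>R simple_root t
     else cheb \<kappa> k *\<^sub>R simple_root s + cheb \<kappa> (Suc k) *\<^sub>R simple_root t)"
proof (induction k)
  case (Suc k)
  have "act_word (altw s t (Suc k)) (simple_root s) =
      srefl (if even k then t else s) (act_word (altw s t k) (simple_root s))"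
    by (simp only: altw_Suc_Cons act_word_simps)
  also have "\<dots> = (if even (Suc k)
      then cheb \<kappa> (Suc (Suc k)) *\<^sub>R simple_root s + cheb \<kappa> (Suc k) *\<^sub>R simple_root t
      else cheb \<kappa> (Suc k) *\<^sub>R simple_root s + cheb \<kappa> (Suc (Suc k)) *\<^sub>R simple_root t)"
    unfolding Suc.IH using assms(1,2)
    by (auto simp: srefl_def \<kappa>_def bil_sym[of s t] algebra_simps simp flip: scaleR_add_left)
  finally show ?case .
qed simp

text \<open>
  With \<open>\<theta> = pi / m\<close>, a word of length \<open>2 m\<close> rotates the plane by the full angle \<open>2 pi\<close>.
\<close>
lemma act_braid_simple_root:
  assumes "s \<in> S" "t \<in> S" "s \<noteq> t" and m: "ord (s \<otimes> t) \<noteq> 0"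
  shows "act_word (altw s t (2 * ord (s \<otimes> t))) (simple_root s) = simple_root s"
    and "act_word (altw s t (2 * ord (s \<otimes> t))) (simple_root t) = simple_root t"
proof -
  define m where "m = ord (s \<otimes> t)"
  define \<theta> where "\<theta> = pi / real m"
  have m2: "m \<ge> 2" using ord_gens_ge_2[OF assms] by (simp add: m_def)
  have \<kappa>: "- 2 * bil s t = 2 * cos \<theta>" by (simp add: bil_def \<theta>_def m_def)
  have \<kappa>': "- 2 * bil t s = 2 * cos \<theta>" using assms \<kappa> by (simp add: bil_sym)
  have sin: "sin \<theta> > 0"
    using m2 by (intro sin_gt_zero) (auto simp: \<theta>_def field_simps)
  have ang: "real (2 * m) * \<theta> = 2 * pi" using m2 by (simp add: \<theta>_def)
  have c0: "cheb (2 * cos \<theta>) (2 * m) = 0"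
    using cheb_sin[of \<theta> "2 * m"] sin unfolding ang by simp
  have ang1: "real (Suc (2 * m)) * \<theta> = \<theta> + 2 * pi" using ang by (simp add: algebra_simps)
  have c1: "cheb (2 * cos \<theta>) (Suc (2 * m)) = 1"
    using cheb_sin[of \<theta> "Suc (2 * m)"] sin unfolding ang1 by simp
  show "act_word (altw s t (2 * ord (s \<otimes> t))) (simple_root s) = simple_root s"
    using act_altw_simple_root[OF assms(1,2), of "2 * m", unfolded \<kappa>] c0 c1 by (simp add: m_def)
  obtain n where n: "2 * m = Suc n" using m2 by (cases "2 * m") auto
  then have "odd n" by presburger
  have "cheb (2 * cos \<theta>) (Suc (Suc n)) = 2 * cos \<theta> * cheb (2 * cos \<theta>) (Suc n) - cheb (2 * cos \<theta>) n"
    by simp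
  then have cn: "cheb (2 * cos \<theta>) n = - 1" using c0 c1 by (simp add: n)
  have "act_word (altw s t (2 * m)) (simple_root t) = act_word (altw t s n @ [t]) (simple_root t)"
    by (simp add: n)
  also have "\<dots> = - act_word (altw t s n) (simple_root t)"
    using assms by (simp add: linear_neg[OF linear_act_word])
  also have "\<dots> = simple_root t"
    using act_altw_simple_root[OF assms(2,1), of n, unfolded \<kappa>'] c0 cn n \<open>odd n\<close> by simp
  finally show "act_word (altw s t (2 * ord (s \<otimes> t))) (simple_root t) = simple_root t"
    by (simp add: m_def)
qed

text \<open>
  The form is nondegenerate on the plane of two simple roots with finite \<open>ord (s t)\<close>, so every
  vector splits into a part in this plane and a part fixed by both reflections.
\<close>
lemma act_braid:
  assumes st: "s \<in> S" "t \<in> S"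
  shows "act_word (altw s t (2 * ord (s \<otimes> t))) v = v"
proof (cases "s = t \<or> ord (s \<otimes> t) = 0")
  case True
  have "altw s s (2 * 1) = [s, s]" by (simp add: numeral_2_eq_2)
  then have "act_word (altw s s (2 * 1)) v = v" using st by simp
  moreover have "ord (s \<otimes> s) = 1" using st by (simp add: ord_eq_1)
  ultimately show ?thesis using True by auto
next
  case False
  let ?m = "ord (s \<otimes> t)"
  define c where "c = bil s t"
  define p where "p = pairing s v"
  define q where "q = pairing t v"
  define d where "d = 1 - c\<^sup>2"
  have "?m \<ge> 2" using ord_gens_ge_2 st False by blast
  then have "sin (pi / real ?m) > 0" by (intro sin_gt_zero) (auto simp: field_simps)
  moreover have "d = (sin (pi / real ?m))\<^sup>2" by (simp add: d_def c_def bil_def sin_squared_eq)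
  ultimately have d: "d \<noteq> 0" by simp
  define a where "a = (p - c * q) / d"
  define b where "b = (q - c * p) / d"
  define v0 where "v0 = v - a *\<^sub>R simple_root s - b *\<^sub>R simple_root t"
  have "a * d = p - c * q" "b * d = q - c * p" using d by (simp_all add: a_def b_def)
  then have "a * d + c * (b * d) = p - c * q + c * (q - c * p)"
    "c * (a * d) + b * d = c * (p - c * q) + (q - c * p)" by simp_all
  moreover have "p - c * q + c * (q - c * p) = p * d" "c * (p - c * q) + (q - c * p) = q * d"
    by (simp_all add: d_def power2_eq_square algebra_simps)
  ultimately have "a * d + c * (b * d) = p * d" "c * (a * d) + b * d = q * d" by simp_all
  then have "(a + c * b) * d = p * d" "(c * a + b) * d = q * d" by (simp_all add: algebra_simps)
  then have ab: "a + c * b = p" "c * a + b = q" using d by simp_all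
  have "pairing s v0 = 0" "pairing t v0 = 0"
    using st ab by (simp_all add: v0_def bil_sym[of s t] p_def[symmetric] q_def[symmetric]
        c_def[symmetric] algebra_simps)
  then have "srefl s v0 = v0" "srefl t v0 = v0" by (simp_all add: srefl_def)
  then have fix0: "act_word ws v0 = v0" if "set ws \<subseteq> {s, t}" for ws
    using that by (induction ws) auto
  have "set (altw s t (2 * ?m)) \<subseteq> {s, t}"
    using altw_in_lists[of s "{s, t}" t] by (auto simp: in_lists_conv_set)
  moreover have "v = v0 + a *\<^sub>R simple_root s + b *\<^sub>R simple_root t" by (simp add: v0_def)
  ultimately show ?thesis
    using fix0 act_braid_simple_root[OF st] False
    by (simp add: linear_add[OF linear_act_word] linear_scale[OF linear_act_word])
qed

lemma act_word_unique:
  assumes "us \<in> lists S" "vs \<in> lists S" "wprod us = wprod vs"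
  shows "act_word us = act_word vs"
proof -
  have rev: "act_word (rev vs) (act_word vs v) = v" for v
    using assms(2) by (induction vs arbitrary: v) auto
  have "act_word (us @ rev vs) = act_word []"
  proof (rule word_relation_invariant)
    show "us @ rev vs \<in> lists S" "wprod (us @ rev vs) = \<one>"
      using assms by (simp_all add: wprod_append wprod_rev)
    fix as bs assume "coxeter_deletion W S as bs"
    then show "act_word as = act_word bs"
      unfolding coxeter_deletion_def concat_replicate_altw
      by (auto simp: fun_eq_iff act_braid)
  qed
  then have "act_word us (act_word (rev vs) (act_word vs v)) = act_word vs v" for v
    by (metis act_word_simps(1,3))
  then show ?thesis by (auto simp: rev)
qed

text \<open>
  The choice of the word does not matter by \<open>act_word_unique\<close>.
\<close>
definition act :: "'a \<Rightarrow> ('a \<Rightarrow>\<^sub>0 real) \<Rightarrow> ('a \<Rightarrow>\<^sub>0 real)" where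
  "act w = act_word (SOME ws. ws \<in> lists S \<and> wprod ws = w)"

lemma act_wprod: "ws \<in> lists S \<Longrightarrow> act (wprod ws) = act_word ws"
  unfolding act_def by (rule someI2[of _ ws]) (auto intro: act_word_unique)

lemma act_mult: 
  assumes "v \<in> carrier W" "w \<in> carrier W"
  shows "act (v \<otimes> w) x = act v (act w x)"
proof -
  obtain vs ws where "vs \<in> lists S" "wprod vs = v" "ws \<in> lists S" "wprod ws = w"
    using assms ex_word by meson
  then show ?thesis
    using act_wprod[of "vs @ ws"] act_wprod[of vs] act_wprod[of ws] by (simp add: wprod_append)
qed

lemma act_one [simp]: "act \<one> v = v"
  using act_wprod[of "[]"] by simp

lemma act_gen: "s \<in> S \<Longrightarrow> act s = srefl s"
  using act_wprod[of "[s]"] by (simp add: fun_eq_iff)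

lemma linear_act: "w \<in> carrier W \<Longrightarrow> linear (act w)"
  using ex_word[of w] act_wprod linear_act_word by metis

lemma act_simps [simp]:
  assumes "w \<in> carrier W"
  shows "act w (u + v) = act w u + act w v" "act w (u - v) = act w u - act w v"
    "act w (- u) = - act w u" "act w (c *\<^sub>R u) = c *\<^sub>R act w u" "act w 0 = 0"
  using linear_act[OF assms]
  by (simp_all add: linear_add linear_diff linear_neg linear_scale linear_0)

lemma act_inv [simp]:
  assumes "w \<in> carrier W"
  shows "act (inv w) (act w v) = v" "act w (act (inv w) v) = v"
  using act_mult[of "inv w" w v] act_mult[of w "inv w" v] assms by simp_all

lemma act_eq_0 [simp]: "w \<in> carrier W \<Longrightarrow> act w v = 0 \<longleftrightarrow> v = 0"
  by (metis act_inv(1) act_simps(5) inv_closed)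

subsection \<open>Positive and negative roots\<close>

definition nonneg :: "('a \<Rightarrow>\<^sub>0 real) \<Rightarrow> bool" where
  "nonneg v \<longleftrightarrow> (\<forall>s. vcoeff v s \<ge> 0)"

definition nonpos :: "('a \<Rightarrow>\<^sub>0 real) \<Rightarrow> bool" where
  "nonpos v \<longleftrightarrow> nonneg (- v)"

lemma nonneg_add: "nonneg u \<Longrightarrow> nonneg v \<Longrightarrow> nonneg (u + v)"
  by (simp add: nonneg_def lookup_add)

lemma nonneg_scale: "nonneg v \<Longrightarrow> c \<ge> 0 \<Longrightarrow> nonneg (c *\<^sub>R v)"
  by (simp add: nonneg_def)

lemma nonneg_nonpos_zero: "nonneg v \<Longrightarrow> nonpos v \<Longrightarrow> v = 0"
  by (intro poly_mapping_eqI) (auto simp: nonneg_def nonpos_def intro: antisym)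

text \<open>
  For finite order the value is a quotient of sines of angles between \<open>0\<close> and \<open>pi\<close>, and for infinite
  order it is \<open>k\<close>.
\<close>
lemma cheb_nonneg:
  assumes "s \<in> S" "t \<in> S" "s \<noteq> t" "ord (s \<otimes> t) = 0 \<or> k \<le> ord (s \<otimes> t)"
  shows "cheb (- 2 * bil s t) k \<ge> 0"
proof (cases "ord (s \<otimes> t) = 0")
  case True
  then show ?thesis by (simp add: bil_def cheb_two)
next
  case False
  define \<theta> where "\<theta> = pi / real (ord (s \<otimes> t))"
  have m2: "ord (s \<otimes> t) \<ge> 2" using ord_gens_ge_2 assms False by blast
  then have sin: "sin \<theta> > 0" by (intro sin_gt_zero) (auto simp: \<theta>_def field_simps)
  have "real k * \<theta> \<le> pi" using assms(4) False m2 by (simp add: \<theta>_def field_simps)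
  moreover have "real k * \<theta> \<ge> 0" by (simp add: \<theta>_def)
  ultimately have "sin (real k * \<theta>) \<ge> 0" by (intro sin_ge_zero) auto
  then have "cheb (2 * cos \<theta>) k \<ge> 0"
    using cheb_sin[of \<theta> k] sin by (metis zero_le_mult_iff not_less)
  then show ?thesis by (simp add: bil_def \<theta>_def)
qed

text \<open>
  Tits' theorem.  Among the reduced words of \<open>w\<close>, take one that ends in a longest possible word
  \<open>us\<close> over \<open>s\<close> and a right descent \<open>t\<close> of \<open>w\<close>.  The part of \<open>w\<close> before \<open>us\<close> has neither \<open>s\<close>
  nor \<open>t\<close> as a right descent, so the induction hypothesis makes it send both simple roots to
  nonnegative vectors, and \<open>us\<close> is alternating and ends in \<open>t\<close>, so it sends \<open>simple_root s\<close> to a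
  nonnegative combination of the two.
\<close>
theorem act_simple_root_nonneg:
  assumes "w \<in> carrier W" "s \<in> S" "len w < len (w \<otimes> s)"
  shows "nonneg (act w (simple_root s))"
  using assms
proof (induction "len w" arbitrary: w s rule: less_induct)
  case less
  show ?case
  proof (cases "w = \<one>")
    case True
    then show ?thesis by (simp add: nonneg_def vcoeff_simple_root)
  next
    case False
    note w = less.prems(1) and s = less.prems(2)
    obtain t where t: "t \<in> S" "len w = Suc (len (w \<otimes> t))"
      using ex_right_descent[OF w False] .
    have st: "s \<noteq> t" using less.prems t by auto
    (* P n: w has a reduced word whose last n letters are in {s, t} *)
    define P where "P n \<longleftrightarrow> (\<exists>vs us. vs \<in> lists S \<and> us \<in> lists {s, t} \<and> wprod (vs @ us) = w \<and>
        length (vs @ us) = len w \<and> length us = n)" for n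
    have sub: "us \<in> lists S" if "us \<in> lists {s, t}" for us
      using that s t(1) by (auto simp: in_lists_conv_set)
    obtain ws where ws: "ws \<in> lists S" "wprod ws = w \<otimes> t" "length ws = len (w \<otimes> t)"
      using ex_reduced[of "w \<otimes> t"] w t by auto
    have "wprod (ws @ [t]) = w" using ws w t by (simp add: wprod_append)
    then have "P 1" unfolding P_def using ws t by (intro exI[of _ ws] exI[of _ "[t]"]) simp
    moreover have bound: "\<forall>n. P n \<longrightarrow> n \<le> len w" by (auto simp: P_def)
    ultimately have max: "P (Greatest P)" "\<And>n. P n \<Longrightarrow> n \<le> Greatest P"
      using GreatestI_nat[of P 1 "len w"] Greatest_le_nat[of P _ "len w"] by blast+
    then obtain vs us where vs: "vs \<in> lists S" and us: "us \<in> lists {s, t}"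
      and prod: "wprod (vs @ us) = w" and red: "length (vs @ us) = len w"
      and len_us: "length us = Greatest P" unfolding P_def by blast
    have us_pos: "us \<noteq> []" using max(2)[OF \<open>P 1\<close>] len_us by auto
    note usS = sub[OF us]
    define v where "v = wprod vs"
    have v: "v \<in> carrier W" using vs by (simp add: v_def)
    have len_v: "len v = length vs"
    proof -
      obtain vs' where vs': "vs' \<in> lists S" "wprod vs' = v" "length vs' = len v"
        using ex_reduced[OF v] .
      then have "wprod (vs' @ us) = w" using prod vs usS by (simp add: wprod_append v_def)
      then have "len w \<le> length (vs' @ us)" using len_le[of "vs' @ us"] vs' usS by simp
      then show ?thesis using red vs'(3) len_le[OF vs] by (simp add: v_def)
    qed
    have no_desc: "nonneg (act v (simple_root r))" if r: "r \<in> {s, t}" for r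
    proof (rule less.hyps)
      show "len v < len w" using len_v red us_pos by (cases us) auto
      show "v \<in> carrier W" by (rule v)
      show rS: "r \<in> S" using r s t by auto
      show "len v < len (v \<otimes> r)"
      proof (rule ccontr)
        assume "\<not> ?thesis"
        then have lv: "len v = Suc (len (v \<otimes> r))"
          by (cases rule: len_right_cases[OF v rS]) simp_all
        obtain vs' where vs': "vs' \<in> lists S" "wprod vs' = v \<otimes> r" "length vs' = len (v \<otimes> r)"
          using ex_reduced[of "v \<otimes> r"] v rS by auto
        (* Moving r from v to us gives a longer final word in {s, t}. *)
        have "v \<otimes> r \<otimes> (r \<otimes> wprod us) = v \<otimes> wprod us"
          using v rS usS by (simp add: m_assoc)
        then have "wprod (vs' @ r # us) = w"
          using vs' usS rS prod vs by (simp add: wprod_append v_def)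
        moreover have "length (vs' @ r # us) = len w" using vs'(3) lv len_v red by simp
        ultimately have "P (Suc (length us))"
          unfolding P_def using vs' us r by (intro exI[of _ vs'] exI[of _ "r # us"]) auto
        then show False using max(2) len_us by fastforce
      qed
    qed
    have ends_s: False if "us' \<in> lists S" "wprod (us' @ [s]) = w" "length (us' @ [s]) = len w" for us'
    proof -
      have "w \<otimes> s = wprod us'" using that s by (simp add: wprod_append flip: that(2))
      then show False using len_le[OF that(1)] that(3) less.prems(3) by simp
    qed
    have "last us \<noteq> s"
    proof
      assume "last us = s"
      then have "us = butlast us @ [s]" using us_pos by (metis append_butlast_last_id)
      moreover from this have "butlast us \<in> lists S" using usS by (metis append_in_lists_conv)
      ultimately show False
        using ends_s[of "vs @ butlast us"] vs prod red by (metis append.assoc append_in_lists_conv)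
    qed
    then have last: "last us = t" using us us_pos last_in_set[of us] by (auto simp: in_lists_conv_set)
    have no_rep: "us \<noteq> as @ c # c # bs" for as c bs
    proof
      assume eq: "us = as @ c # c # bs"
      then have S: "as \<in> lists S" "c \<in> S" "bs \<in> lists S" using usS by auto
      then have "wprod us = wprod (as @ bs)" using eq by (simp add: wprod_append)
      then have "wprod (vs @ as @ bs) = w" using prod vs usS S by (simp add: wprod_append)
      then show False using len_le[of "vs @ as @ bs"] vs S red eq by simp
    qed
    have alt: "us = altw s t (length us)"
      using alternating_word[of us s t] us us_pos last st no_rep by (auto simp: in_lists_conv_set)
    (* Otherwise a braid relation would produce a reduced word of w that ends in s. *)
    have short: "length us < ord (s \<otimes> t)" if nz: "ord (s \<otimes> t) \<noteq> 0"
    proof (rule ccontr)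
      let ?m = "ord (s \<otimes> t)"
      assume "\<not> length us < ?m"
      then obtain k where "length us = k + ?m" by (metis add.commute le_Suc_ex not_less)
      then obtain as where as: "us = as @ altw s t ?m" "set as \<subseteq> {s, t}"
        using alt altw_add by metis
      obtain m where m: "?m = Suc m" using nz by (cases ?m) auto
      have S: "as \<in> lists S" "altw s t ?m \<in> lists S" "altw t s ?m \<in> lists S"
        "altw s t m \<in> lists S"
      proof -
        show "as \<in> lists S" using as(2) s t(1) by (auto simp: in_lists_conv_set)
      qed (rule altw_in_lists[OF s t(1)] altw_in_lists[OF t(1) s])+
      have "wprod (vs @ as @ altw t s ?m) = wprod (vs @ as @ altw s t ?m)"
        using S(1-3) vs by (simp only: wprod_append append_in_lists_conv braid_relation[OF s t(1)] simp_thms)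
      also have "\<dots> = w" using prod as(1) by simp
      finally have "wprod ((vs @ as @ altw s t m) @ [s]) = w" using m by simp
      moreover have "length ((vs @ as @ altw s t m) @ [s]) = len w" using red as(1) m by simp
      ultimately show False using ends_s[of "vs @ as @ altw s t m"] vs S by simp
    qed
    define \<kappa> where "\<kappa> = - 2 * bil s t"
    have "cheb \<kappa> (length us) \<ge> 0" "cheb \<kappa> (Suc (length us)) \<ge> 0"
      unfolding \<kappa>_def using short by (intro cheb_nonneg s t(1) st; fastforce)+
    moreover have "act_word us (simple_root s) = act_word (altw s t (length us)) (simple_root s)"
      using arg_cong[OF alt, of act_word] by (rule fun_cong)
    ultimately obtain a b where ab: "a \<ge> 0" "b \<ge> 0"
      "act_word us (simple_root s) = a *\<^sub>R simple_root s + b *\<^sub>R simple_root t"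
      unfolding act_altw_simple_root[OF s t(1)] \<kappa>_def[symmetric]
      by (cases "even (length us)") auto
    have "act w (simple_root s) = act v (act_word us (simple_root s))"
      using prod vs usS act_wprod act_mult[of v "wprod us"] by (auto simp: v_def wprod_append)
    also have "\<dots> = a *\<^sub>R act v (simple_root s) + b *\<^sub>R act v (simple_root t)"
      using ab v by simp
    finally show ?thesis using no_desc ab by (simp add: nonneg_add nonneg_scale)
  qed
qed


lemma inv_cancel [simp]:
  assumes "w \<in> carrier W" "v \<in> carrier W"
  shows "inv w \<otimes> (w \<otimes> v) = v" "w \<otimes> (inv w \<otimes> v) = v"
  using assms by (simp_all flip: m_assoc)

section \<open>Roots of reflections\<close>

text \<open>
  A reflection has two roots, each the negative of the other.  A relation avoids a choice between
  them, and it lets a root be moved along with the conjugation of its reflection.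
\<close>
definition root_of :: "'a \<Rightarrow> ('a \<Rightarrow>\<^sub>0 real) \<Rightarrow> bool" where
  "root_of t \<beta> \<longleftrightarrow> (\<exists>w \<in> carrier W. \<exists>s \<in> S. t = w \<otimes> s \<otimes> inv w \<and> \<beta> = act w (simple_root s))"

lemma root_ofE:
  assumes "root_of t \<beta>"
  obtains w s where "w \<in> carrier W" "s \<in> S" "t = w \<otimes> s \<otimes> inv w" "\<beta> = act w (simple_root s)"
  using assms unfolding root_of_def by blast

lemma root_of_simple: "s \<in> S \<Longrightarrow> root_of s (simple_root s)"
  unfolding root_of_def by (intro bexI[of _ \<one>] bexI[of _ s]) auto

lemma root_of_carrier: "root_of t \<beta> \<Longrightarrow> t \<in> carrier W"
  by (elim root_ofE) simp

lemma root_of_nonzero: "root_of t \<beta> \<Longrightarrow> \<beta> \<noteq> 0"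
  by (elim root_ofE) simp

lemma root_of_uminus:
  assumes "root_of t \<beta>" shows "root_of t (- \<beta>)"
proof -
  obtain w s where w: "w \<in> carrier W" "s \<in> S" "t = w \<otimes> s \<otimes> inv w" "\<beta> = act w (simple_root s)"
    using assms by (rule root_ofE)
  then have "t = (w \<otimes> s) \<otimes> s \<otimes> inv (w \<otimes> s)" "- \<beta> = act (w \<otimes> s) (simple_root s)"
    by (simp_all add: inv_mult_group m_assoc act_mult act_gen)
  then show ?thesis unfolding root_of_def using w by blast
qed

lemma root_of_conj:
  assumes "root_of t \<beta>" "u \<in> carrier W"
  shows "root_of (u \<otimes> t \<otimes> inv u) (act u \<beta>)"
proof -
  obtain w s where w: "w \<in> carrier W" "s \<in> S" "t = w \<otimes> s \<otimes> inv w" "\<beta> = act w (simple_root s)"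
    using assms(1) by (rule root_ofE)
  then have "u \<otimes> t \<otimes> inv u = (u \<otimes> w) \<otimes> s \<otimes> inv (u \<otimes> w)"
    "act u \<beta> = act (u \<otimes> w) (simple_root s)"
    using assms(2) by (simp_all add: inv_mult_group m_assoc act_mult)
  then show ?thesis unfolding root_of_def using w assms(2) by blast
qed

lemma root_of_pos_or_neg:
  assumes "root_of t \<beta>" shows "nonneg \<beta> \<or> nonpos \<beta>"
proof -
  obtain w s where w: "w \<in> carrier W" "s \<in> S" "\<beta> = act w (simple_root s)"
    using assms by (rule root_ofE)
  show ?thesis
  proof (cases rule: len_right_cases[OF w(1,2)])
    case 1
    then show ?thesis using act_simple_root_nonneg[of w s] w by simp
  next
    case 2
    then have "nonneg (act (w \<otimes> s) (simple_root s))"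
      using act_simple_root_nonneg[of "w \<otimes> s" s] w by simp
    then show ?thesis using w by (simp add: act_mult act_gen nonpos_def)
  qed
qed

lemma reflection_root:
  assumes "t \<in> reflections W S"
  obtains \<beta> where "root_of t \<beta>" "nonneg \<beta>"
proof -
  obtain \<beta> where "root_of t \<beta>" using assms unfolding reflections_def root_of_def by blast
  then show thesis using that root_of_pos_or_neg[of t \<beta>] root_of_uminus[of t \<beta>]
    unfolding nonpos_def by blast
qed

lemma root_of_reflection: "root_of t \<beta> \<Longrightarrow> t \<in> reflections W S"
  unfolding reflections_def root_of_def by blast

lemma reflections_carrier: "t \<in> reflections W S \<Longrightarrow> t \<in> carrier W"
  by (elim reflection_root) (rule root_of_carrier)

lemma gen_reflection: "s \<in> S \<Longrightarrow> s \<in> reflections W S"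
  using root_of_reflection root_of_simple by blast

lemma reflections_conj: "t \<in> reflections W S \<Longrightarrow> u \<in> carrier W \<Longrightarrow> u \<otimes> t \<otimes> inv u \<in> reflections W S"
  by (elim reflection_root) (rule root_of_reflection[OF root_of_conj])

lemma reflection_square [simp]:
  assumes "t \<in> reflections W S" shows "t \<otimes> t = \<one>"
proof -
  obtain w s where w: "w \<in> carrier W" "s \<in> S" "t = w \<otimes> s \<otimes> inv w"
    using assms unfolding reflections_def by blast
  then show ?thesis by (simp add: m_assoc)
qed

lemma act_root_of:
  assumes "root_of t \<beta>"
  obtains c where "act t v = v + c *\<^sub>R \<beta>"
proof -
  obtain w s where w: "w \<in> carrier W" "s \<in> S" "t = w \<otimes> s \<otimes> inv w" "\<beta> = act w (simple_root s)"
    using assms by (rule root_ofE)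
  then have "act t v = v + (- 2 * pairing s (act (inv w) v)) *\<^sub>R \<beta>"
    by (simp add: act_mult act_gen srefl_def)
  then show thesis by (rule that)
qed

lemma act_root_of_self: "root_of t \<beta> \<Longrightarrow> act t \<beta> = - \<beta>"
  by (elim root_ofE) (simp add: act_mult act_gen)

text \<open>
  If \<open>r\<close> has a multiple of \<open>simple_root s\<close> as a root, then \<open>s r\<close> fixes this vector and moves every
  other vector along it, so it sends no simple root to a nonpositive vector.  An element without
  right descents is the identity.
\<close>
lemma root_of_multiple_simple:
  assumes r: "root_of r (c *\<^sub>R simple_root s)" and s: "s \<in> S"
  shows "r = s"
proof -
  have rW: "r \<in> carrier W" using root_of_carrier[OF r] .
  have c: "c \<noteq> 0" using root_of_nonzero[OF r] by auto
  have "c *\<^sub>R act r (simple_root s) = c *\<^sub>R - simple_root s"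
    using act_root_of_self[OF r] rW by simp
  then have rs: "act r (simple_root s) = - simple_root s" using c by (metis scaleR_left_imp_eq)
  define g where "g = s \<otimes> r"
  have g: "g \<in> carrier W" using rW s by (simp add: g_def)
  have gs: "act g (simple_root s) = simple_root s"
    using rs rW s by (simp add: g_def act_mult act_gen linear_neg[OF linear_srefl])
  have "g = \<one>"
  proof (rule ccontr)
    assume "g \<noteq> \<one>"
    then obtain t where t: "t \<in> S" "len g = Suc (len (g \<otimes> t))" by (rule ex_right_descent[OF g])
    have "nonneg (act (g \<otimes> t) (simple_root t))" using act_simple_root_nonneg[of "g \<otimes> t" t] t g by simp
    then have neg: "nonneg (- act g (simple_root t))" using t g by (simp add: act_mult act_gen)
    obtain d where d: "act r (simple_root t) = simple_root t + d *\<^sub>R (c *\<^sub>R simple_root s)"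
      using act_root_of[OF r] .
    define e where "e = - 2 * bil s t"
    have e: "srefl s (simple_root t) = simple_root t + e *\<^sub>R simple_root s"
      by (simp add: srefl_def e_def)
    have gt: "act g (simple_root t) = simple_root t + (e - d * c) *\<^sub>R simple_root s"
      using d e rW s by (simp add: g_def act_mult act_gen linear_add[OF linear_srefl]
          linear_scale[OF linear_srefl] scaleR_diff_left)
    show False
    proof (cases "s = t")
      case True
      then show False using neg gs by (auto simp: nonneg_def vcoeff_simple_root dest: spec[of _ s])
    next
      case False
      then have "vcoeff (act g (simple_root t)) t = 1"
        by (simp add: gt lookup_add vcoeff_simple_root)
      then show False using neg by (auto simp: nonneg_def dest: spec[of _ t])
    qed
  qed
  then have "s \<otimes> (s \<otimes> r) = s" using s by (simp add: g_def)
  then show ?thesis using s rW by simp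
qed

lemma root_of_multiple:
  assumes t: "root_of t \<beta>" and r: "root_of r (c *\<^sub>R \<beta>)"
  shows "r = t"
proof -
  obtain w s where w: "w \<in> carrier W" "s \<in> S" "t = w \<otimes> s \<otimes> inv w" "\<beta> = act w (simple_root s)"
    using t by (rule root_ofE)
  have rW: "r \<in> carrier W" using root_of_carrier[OF r] .
  have "root_of (inv w \<otimes> r \<otimes> w) (c *\<^sub>R simple_root s)"
    using root_of_conj[OF r, of "inv w"] w by simp
  then have "inv w \<otimes> r \<otimes> w = s" using root_of_multiple_simple w by blast
  moreover have "w \<otimes> (inv w \<otimes> r \<otimes> w) \<otimes> inv w = r"
    using w rW by (simp add: m_assoc)
  ultimately show ?thesis using w by simp
qed

text \<open>
  A simple reflection changes a single coefficient, so it can only make its own positive root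
  negative.
\<close>
lemma srefl_nonneg:
  assumes t: "root_of t \<beta>" and pos: "nonneg \<beta>" and s: "s \<in> S" and "t \<noteq> s"
  shows "nonneg (srefl s \<beta>)"
proof (rule ccontr)
  assume "\<not> ?thesis"
  moreover have "root_of (s \<otimes> t \<otimes> inv s) (srefl s \<beta>)" using root_of_conj[OF t, of s] s by (simp add: act_gen)
  ultimately have neg: "nonpos (srefl s \<beta>)" using root_of_pos_or_neg by blast
  have "vcoeff \<beta> r = 0" if "r \<noteq> s" for r
  proof -
    have "vcoeff (srefl s \<beta>) r = vcoeff \<beta> r"
      using that by (simp add: srefl_def lookup_minus vcoeff_simple_root)
    then show ?thesis using neg pos by (metis nonneg_def nonpos_def lookup_uminus
          neg_0_le_iff_le order_antisym)
  qed
  then have "\<beta> = vcoeff \<beta> s *\<^sub>R simple_root s"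
    by (intro poly_mapping_eqI) (auto simp: vcoeff_simple_root)
  then show False using root_of_multiple_simple t s \<open>t \<noteq> s\<close> by metis
qed

text \<open>
  The strong exchange condition: the letter at which the positive root \<open>\<beta>\<close> becomes negative can
  be deleted.
\<close>
lemma strong_exchange:
  assumes "ws \<in> lists S" "root_of t \<beta>" "nonneg \<beta>" "nonpos (act_word ws \<beta>)"
  shows "len (wprod ws \<otimes> t) < length ws"
  using assms(1,4)
proof (induction ws)
  case Nil
  then show ?case using nonneg_nonpos_zero[OF assms(3)] root_of_nonzero[OF assms(2)] by simp
next
  case (Cons s ws)
  have S: "s \<in> S" "ws \<in> lists S" and tW: "t \<in> carrier W"
    using Cons.hyps root_of_carrier[OF assms(2)] by simp_all
  let ?u = "wprod ws"
  show ?case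
  proof (cases "nonpos (act_word ws \<beta>)")
    case True
    then have "len (?u \<otimes> t) < length ws" using Cons.IH S by blast
    moreover have "len (s \<otimes> (?u \<otimes> t)) \<le> Suc (len (?u \<otimes> t))"
      using len_mult_gen_le(2) S tW by simp
    ultimately show ?thesis using S tW by (simp add: m_assoc)
  next
    case False
    have root: "root_of (?u \<otimes> t \<otimes> inv ?u) (act_word ws \<beta>)"
      using root_of_conj[OF assms(2), of ?u] S act_wprod by simp
    then have pos: "nonneg (act_word ws \<beta>)" using False root_of_pos_or_neg by blast
    have "?u \<otimes> t \<otimes> inv ?u = s"
    proof (rule ccontr)
      assume "?u \<otimes> t \<otimes> inv ?u \<noteq> s"
      then have "nonneg (srefl s (act_word ws \<beta>))" using srefl_nonneg root pos S by blast
      then have "srefl s (act_word ws \<beta>) = 0" using Cons.prems nonneg_nonpos_zero by simp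
      then have "act_word ws \<beta> = 0" using S by (metis act_gen act_eq_0 S_carrier)
      then show False using root_of_nonzero[OF root] by simp
    qed
    then have "?u \<otimes> t \<otimes> inv ?u \<otimes> ?u = s \<otimes> ?u" by simp
    then have "?u \<otimes> t = s \<otimes> ?u" using S tW by (simp add: m_assoc)
    then have "s \<otimes> ?u \<otimes> t = ?u" using S tW by (simp add: m_assoc)
    then show ?thesis using len_le[OF S(2)] by simp
  qed
qed

lemma len_reflection_neg:
  assumes "z \<in> carrier W" "root_of t \<beta>" "nonneg \<beta>" "nonpos (act z \<beta>)"
  shows "len (z \<otimes> t) < len z"
proof -
  obtain ws where "ws \<in> lists S" "wprod ws = z" "length ws = len z" using ex_reduced[OF assms(1)] .
  then show ?thesis using strong_exchange[of ws t \<beta>] assms act_wprod by force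
qed

lemma len_reflection_pos:
  assumes "z \<in> carrier W" "root_of t \<beta>" "nonneg \<beta>" "nonneg (act z \<beta>)"
  shows "len z < len (z \<otimes> t)"
proof -
  have t: "t \<in> carrier W" "t \<in> reflections W S"
    using assms(2) root_of_carrier root_of_reflection by blast+
  have "nonpos (act (z \<otimes> t) \<beta>)"
    using assms t act_root_of_self[OF assms(2)] by (simp add: act_mult nonpos_def)
  then have "len (z \<otimes> t \<otimes> t) < len (z \<otimes> t)" using len_reflection_neg assms t by simp
  then show ?thesis using t assms(1) by (simp add: m_assoc)
qed

text \<open>
  If \<open>s\<close> on the left and \<open>t\<close> on the right both lengthen \<open>x\<close>, but together do not, then \<open>s\<close> makes
  the positive image of \<open>simple_root t\<close> under \<open>x\<close> negative, so this image is a root of \<open>s\<close>.  If both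
  shorten \<open>x\<close>, the same applies to \<open>x t\<close>.
\<close>
lemma exchange_both_sides:
  assumes x: "x \<in> carrier W" and s: "s \<in> S" and t: "t \<in> S"
    and "len (s \<otimes> x) = len (x \<otimes> t)" "len (s \<otimes> x \<otimes> t) = len x"
  shows "s \<otimes> x = x \<otimes> t"
proof -
  have up: "s \<otimes> x = x \<otimes> t"
    if x: "x \<in> carrier W" and l: "len (s \<otimes> x) = len (x \<otimes> t)" "len (s \<otimes> x \<otimes> t) = len x"
      "len x < len (x \<otimes> t)" for x
  proof -
    have pos: "nonneg (act x (simple_root t))" using act_simple_root_nonneg x t l by blast
    have root: "root_of (x \<otimes> t \<otimes> inv x) (act x (simple_root t))"
      using root_of_conj root_of_simple x t by blast
    have "x \<otimes> t \<otimes> inv x = s"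
    proof (rule ccontr)
      assume "x \<otimes> t \<otimes> inv x \<noteq> s"
      then have "nonneg (act (s \<otimes> x) (simple_root t))"
        using srefl_nonneg root pos x s t by (simp add: act_mult act_gen)
      then have "len (s \<otimes> x) < len (s \<otimes> x \<otimes> t)"
        using len_reflection_pos[of "s \<otimes> x" t "simple_root t"] root_of_simple x s t
        by (simp add: nonneg_def vcoeff_simple_root)
      then show False using l by simp
    qed
    then have "x \<otimes> t \<otimes> inv x \<otimes> x = s \<otimes> x" by simp
    then show ?thesis using x s t by (simp add: m_assoc)
  qed
  show ?thesis
  proof (cases rule: len_right_cases[OF x t])
    case 1
    then show ?thesis using up assms by simp
  next
    case 2
    have "s \<otimes> (x \<otimes> t) = x \<otimes> t \<otimes> t"
      using up[of "x \<otimes> t"] assms 2 by (simp add: m_assoc)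
    then have "s \<otimes> (s \<otimes> (x \<otimes> t)) = s \<otimes> x" using x t by simp
    then show ?thesis using x s t by simp
  qed
qed


section \<open>The Bruhat order\<close>

abbreviation step :: "'a \<Rightarrow> 'a \<Rightarrow> bool" where "step \<equiv> bruhat_step W S"

abbreviation le (infix "\<preceq>" 50) where "x \<preceq> y \<equiv> bruhat_le W S x y"

abbreviation interval :: "'a \<Rightarrow> 'a \<Rightarrow> 'a set" where "interval \<equiv> bruhat_interval W S"

lemma step_carrier: "step x y \<Longrightarrow> x \<in> carrier W \<and> y \<in> carrier W"
  by (auto simp: bruhat_step_def reflections_carrier)

lemma step_len: "step x y \<Longrightarrow> len x < len y"
  by (simp add: bruhat_step_def)

lemma le_carrier: "x \<preceq> y \<Longrightarrow> x \<in> carrier W \<and> y \<in> carrier W"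
  by (simp add: bruhat_le_def)

lemma le_refl [simp]: "x \<in> carrier W \<Longrightarrow> x \<preceq> x"
  by (simp add: bruhat_le_def)

lemma le_trans [trans]: "x \<preceq> y \<Longrightarrow> y \<preceq> z \<Longrightarrow> x \<preceq> z"
  by (auto simp: bruhat_le_def)

lemma step_le: "step x y \<Longrightarrow> x \<preceq> y"
  using step_carrier by (auto simp: bruhat_le_def)

lemma le_len: 
  assumes "x \<preceq> y" shows "x = y \<or> len x < len y"
proof -
  have "(step)\<^sup>*\<^sup>* x y" using assms by (simp add: bruhat_le_def)
  then show ?thesis by (induction rule: rtranclp_induct) (auto dest: step_len)
qed

lemma step_gen: "z \<in> carrier W \<Longrightarrow> s \<in> S \<Longrightarrow> len z < len (z \<otimes> s) \<Longrightarrow> step z (z \<otimes> s)"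
  unfolding bruhat_step_def using gen_reflection by blast

lemma step_gen_down:
  assumes "z \<in> carrier W" "s \<in> S" "len (z \<otimes> s) < len z" shows "step (z \<otimes> s) z"
  using step_gen[of "z \<otimes> s" s] assms by simp

lemma less_gen_iff:
  assumes "z \<in> carrier W" "s \<in> S"
  shows "bruhat_less W S (z \<otimes> s) z \<longleftrightarrow> len (z \<otimes> s) < len z"
    "bruhat_less W S z (z \<otimes> s) \<longleftrightarrow> len z < len (z \<otimes> s)"
proof -
  have neq: "z \<otimes> s \<noteq> z" using len_gen_parity(1)[OF assms] by auto
  then show "bruhat_less W S (z \<otimes> s) z \<longleftrightarrow> len (z \<otimes> s) < len z"
    using step_le[OF step_gen_down[OF assms]] le_len[of "z \<otimes> s" z] unfolding bruhat_less_def by blast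
  show "bruhat_less W S z (z \<otimes> s) \<longleftrightarrow> len z < len (z \<otimes> s)"
    using neq step_le[OF step_gen[OF assms]] le_len[of z "z \<otimes> s"] unfolding bruhat_less_def by metis
qed

lemma le_induct [consumes 1, case_names refl step]:
  assumes "x \<preceq> y" "P x" "\<And>u v. x \<preceq> u \<Longrightarrow> step u v \<Longrightarrow> P u \<Longrightarrow> P v"
  shows "P y"
proof -
  have x: "x \<in> carrier W" using assms(1) le_carrier by blast
  have "(step)\<^sup>*\<^sup>* x y" using assms(1) by (simp add: bruhat_le_def)
  then have "P y \<and> x \<preceq> y"
    by (induction rule: rtranclp_induct) (use assms(2,3) x le_refl step_le le_trans in blast)+
  then show ?thesis ..
qed

lemma le_converse_induct [consumes 1, case_names refl step]:
  assumes "x \<preceq> y" "P y" "\<And>u v. v \<preceq> y \<Longrightarrow> step u v \<Longrightarrow> P v \<Longrightarrow> P u"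
  shows "P x"
proof -
  have y: "y \<in> carrier W" using assms(1) le_carrier by blast
  have "(step)\<^sup>*\<^sup>* x y" using assms(1) by (simp add: bruhat_le_def)
  then have "P x \<and> x \<preceq> y"
    by (induction rule: converse_rtranclp_induct) (use assms(2,3) y le_refl step_le le_trans in blast)+
  then show ?thesis ..
qed

text \<open>
  The reflection \<open>t\<close> of the edge is not \<open>s\<close>, so \<open>s\<close> keeps its positive root positive, and the
  translated edge has a root with the same sign at its lower end.
\<close>
lemma step_mult_gen:
  assumes "step z w" and s: "s \<in> S" and "w \<noteq> z \<otimes> s"
  shows "step (z \<otimes> s) (w \<otimes> s)"
proof -
  obtain t where z: "z \<in> carrier W" and t: "t \<in> reflections W S" and w: "w = z \<otimes> t"
    and l: "len z < len w"
    using assms(1) unfolding bruhat_step_def by blast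
  have tW: "t \<in> carrier W" using reflections_carrier t .
  obtain \<beta> where \<beta>: "root_of t \<beta>" "nonneg \<beta>" using reflection_root[OF t] .
  have "nonneg (act z \<beta>)"
    using len_reflection_neg[OF z \<beta>] root_of_pos_or_neg[OF root_of_conj[OF \<beta>(1) z]] l w by auto
  then have "nonneg (act (z \<otimes> s) (srefl s \<beta>))" using z s by (simp add: act_mult act_gen)
  moreover have "nonneg (srefl s \<beta>)" using srefl_nonneg[OF \<beta> s] assms(3) w by blast
  moreover have root: "root_of (s \<otimes> t \<otimes> inv s) (srefl s \<beta>)"
    using root_of_conj[OF \<beta>(1), of s] s by (simp add: act_gen)
  moreover have ws: "w \<otimes> s = z \<otimes> s \<otimes> (s \<otimes> t \<otimes> inv s)"
    using z s tW w by (simp add: m_assoc)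
  ultimately have "len (z \<otimes> s) < len (w \<otimes> s)" using len_reflection_pos[of "z \<otimes> s"] z s by simp
  then show ?thesis
    unfolding bruhat_step_def using ws root root_of_reflection z s by blast
qed

text \<open>
  Both forms of the lifting property follow by carrying a chain from \<open>u\<close> to \<open>v\<close> along the
  multiplication by \<open>s\<close>, until it meets one of its own edges.
\<close>
lemma lifting_up:
  assumes "u \<preceq> v" "s \<in> S" shows "u \<otimes> s \<preceq> v \<or> u \<otimes> s \<preceq> v \<otimes> s"
  using assms(1)
proof (induction rule: le_converse_induct)
  case refl
  then show ?case using assms le_carrier by simp
next
  case (step u u')
  show ?case
  proof (cases "u' = u \<otimes> s")
    case False
    then have "u \<otimes> s \<preceq> u' \<otimes> s" using step_mult_gen step assms(2) step_le by blast
    then show ?thesis using step.IH le_trans by blast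
  qed (use step in simp)
qed

lemma lifting_down:
  assumes "u \<preceq> v" "s \<in> S" shows "u \<preceq> v \<otimes> s \<or> u \<otimes> s \<preceq> v \<otimes> s"
  using assms(1)
proof (induction rule: le_induct)
  case refl
  then show ?case using assms le_carrier by simp
next
  case (step v' v)
  show ?case
  proof (cases "v = v' \<otimes> s")
    case True
    then have "v \<otimes> s = v'" using step step_carrier assms(2) by simp
    then show ?thesis using step by simp
  next
    case False
    then have "v' \<otimes> s \<preceq> v \<otimes> s" using step_mult_gen step assms(2) step_le by blast
    then show ?thesis using step.IH le_trans by blast
  qed
qed

lemma le_gen_up: "z \<in> carrier W \<Longrightarrow> s \<in> S \<Longrightarrow> len z < len (z \<otimes> s) \<Longrightarrow> z \<preceq> z \<otimes> s"
  using step_gen step_le by blast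

lemma le_gen_down: "z \<in> carrier W \<Longrightarrow> s \<in> S \<Longrightarrow> len (z \<otimes> s) < len z \<Longrightarrow> z \<otimes> s \<preceq> z"
  using step_gen_down step_le by blast

lemma lift_left_ascent:
  assumes "u \<preceq> v" "s \<in> S" "len u < len (u \<otimes> s)" shows "u \<preceq> v \<otimes> s"
  using lifting_down[OF assms(1,2)] le_gen_up[of u s] assms le_carrier le_trans by blast

lemma lift_right_descent:
  assumes "u \<preceq> v" "s \<in> S" "len (v \<otimes> s) < len v" shows "u \<otimes> s \<preceq> v"
  using lifting_up[OF assms(1,2)] le_gen_down[of v s] assms le_carrier le_trans by blast

lemma lift_both_descent:
  assumes "u \<preceq> v" "s \<in> S" "len (u \<otimes> s) < len u" shows "u \<otimes> s \<preceq> v \<otimes> s"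
  using lifting_down[OF assms(1,2)] le_gen_down[of u s] assms le_carrier le_trans by blast

lemma le_one: "x \<preceq> \<one> \<Longrightarrow> x = \<one>"
  using le_len by fastforce

lemma finite_lower_set:
  assumes "y \<in> carrier W" shows "finite {z. z \<preceq> y}"
  using assms
proof (induction "len y" arbitrary: y rule: less_induct)
  case less
  show ?case
  proof (cases "y = \<one>")
    case True
    then have "{z. z \<preceq> y} \<subseteq> {\<one>}" using le_one by auto
    then show ?thesis using finite_subset by blast
  next
    case False
    then obtain s where s: "s \<in> S" "len y = Suc (len (y \<otimes> s))" by (rule ex_right_descent[OF less.prems])
    let ?A = "{z. z \<preceq> y \<otimes> s}"
    have fin: "finite ?A" using less.hyps[of "y \<otimes> s"] s less.prems by simp
    have "{z. z \<preceq> y} \<subseteq> ?A \<union> (\<lambda>z. z \<otimes> s) ` ?A"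
    proof
      fix z assume "z \<in> {z. z \<preceq> y}"
      then have "z \<preceq> y" by simp
      moreover from this have "z = z \<otimes> s \<otimes> s" using s le_carrier by simp
      ultimately show "z \<in> ?A \<union> (\<lambda>z. z \<otimes> s) ` ?A" using lifting_down[of z y s] s by blast
    qed
    then show ?thesis using fin finite_subset by blast
  qed
qed

lemma finite_interval: "y \<in> carrier W \<Longrightarrow> finite (interval x y)"
  unfolding bruhat_interval_def by (rule finite_subset[OF _ finite_lower_set]) auto


section \<open>Existence and recursion of the R-polynomials\<close>

definition qq :: "int poly" where "qq = [:0, 1:]"

lemma qq_nonzero [simp]: "qq \<noteq> 0"
  by (simp add: qq_def)

lemma len_descent: "w \<in> carrier W \<Longrightarrow> s \<in> S \<Longrightarrow> len (w \<otimes> s) < len w \<Longrightarrow> len w = Suc (len (w \<otimes> s))"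
  by (erule (1) len_right_cases) simp_all

lemma len_ascent: "w \<in> carrier W \<Longrightarrow> s \<in> S \<Longrightarrow> len w < len (w \<otimes> s) \<Longrightarrow> len (w \<otimes> s) = Suc (len w)"
  by (erule (1) len_right_cases) simp_all

text \<open>
  On functions that give the coefficients with respect to the standard basis, \<open>hecke_R t\<close> is right
  multiplication by a generator \<open>T\<close> of the Hecke algebra, normalized by \<open>T\<^sup>2 = q - (q - 1) T\<close>, and
  \<open>bar_R t\<close> is right multiplication by \<open>q T\<^sup>-\<^sup>1\<close>.  The formula for the latter is the recursion
  of the R-polynomials.  The operators with \<open>L\<close> multiply from the left.
\<close>
definition hecke_R :: "'a \<Rightarrow> ('a \<Rightarrow> int poly) \<Rightarrow> 'a \<Rightarrow> int poly" where
  "hecke_R t \<rho> x = (if x \<in> carrier W then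
     if len (x \<otimes> t) < len x then \<rho> (x \<otimes> t) - (qq - 1) * \<rho> x else qq * \<rho> (x \<otimes> t) else 0)"

definition hecke_L :: "'a \<Rightarrow> ('a \<Rightarrow> int poly) \<Rightarrow> 'a \<Rightarrow> int poly" where
  "hecke_L s \<rho> x = (if x \<in> carrier W then
     if len (s \<otimes> x) < len x then \<rho> (s \<otimes> x) - (qq - 1) * \<rho> x else qq * \<rho> (s \<otimes> x) else 0)"

definition bar_R :: "'a \<Rightarrow> ('a \<Rightarrow> int poly) \<Rightarrow> 'a \<Rightarrow> int poly" where
  "bar_R t \<rho> x = hecke_R t \<rho> x + (qq - 1) * \<rho> x"

definition bar_L :: "'a \<Rightarrow> ('a \<Rightarrow> int poly) \<Rightarrow> 'a \<Rightarrow> int poly" where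
  "bar_L s \<rho> x = hecke_L s \<rho> x + (qq - 1) * \<rho> x"

definition basis :: "'a \<Rightarrow> 'a \<Rightarrow> int poly" where
  "basis z x = (if x = z then 1 else 0)"

definition supported :: "('a \<Rightarrow> int poly) \<Rightarrow> bool" where
  "supported \<rho> \<longleftrightarrow> (\<forall>x. x \<notin> carrier W \<longrightarrow> \<rho> x = 0)"

lemma supported_bar_R: "supported \<rho> \<Longrightarrow> supported (bar_R t \<rho>)"
  by (simp add: supported_def bar_R_def hecke_R_def)

lemma supported_hecke_R: "supported (hecke_R t \<rho>)"
  by (simp add: supported_def hecke_R_def)

lemma supported_fold_bar_R: "supported \<rho> \<Longrightarrow> supported (fold bar_R ws \<rho>)"
  by (induction ws arbitrary: \<rho>) (auto simp: supported_bar_R)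

lemma supported_basis: "z \<in> carrier W \<Longrightarrow> supported (basis z)"
  by (auto simp: supported_def basis_def)

text \<open>
  If \<open>s x\<close> and \<open>x t\<close> have different lengths, then \<open>s x t\<close> is as long as \<open>x\<close>.  If they have the same
  length, \<open>exchange_both_sides\<close> excludes this, so both multiplications change the length in the same
  direction twice.
\<close>
lemma descents_independent:
  assumes "x \<in> carrier W" "s \<in> S" "t \<in> S" "s \<otimes> x \<noteq> x \<otimes> t"
  shows "len (s \<otimes> x \<otimes> t) < len (x \<otimes> t) \<longleftrightarrow> len (s \<otimes> x) < len x"
    and "len (s \<otimes> x \<otimes> t) < len (s \<otimes> x) \<longleftrightarrow> len (x \<otimes> t) < len x"
proof -
  have a: "s \<otimes> (x \<otimes> t) = s \<otimes> x \<otimes> t" using assms by (simp add: m_assoc)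
  have ex: "len (s \<otimes> x) = len (x \<otimes> t) \<Longrightarrow> len (s \<otimes> x \<otimes> t) \<noteq> len x"
    using exchange_both_sides assms by blast
  have "len (s \<otimes> x) = Suc (len x) \<or> len x = Suc (len (s \<otimes> x))"
    by (rule len_left_cases[of x s]) (use assms in auto)
  moreover have "len (x \<otimes> t) = Suc (len x) \<or> len x = Suc (len (x \<otimes> t))"
    by (rule len_right_cases[of x t]) (use assms in auto)
  moreover have "len (s \<otimes> x \<otimes> t) = Suc (len (s \<otimes> x)) \<or> len (s \<otimes> x) = Suc (len (s \<otimes> x \<otimes> t))"
    by (rule len_right_cases[of "s \<otimes> x" t]) (use assms in auto)
  moreover have "len (s \<otimes> x \<otimes> t) = Suc (len (x \<otimes> t)) \<or> len (x \<otimes> t) = Suc (len (s \<otimes> x \<otimes> t))"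
    using len_left_cases[of "x \<otimes> t" s] assms a by (metis S_carrier m_closed)
  ultimately show "len (s \<otimes> x \<otimes> t) < len (x \<otimes> t) \<longleftrightarrow> len (s \<otimes> x) < len x"
    and "len (s \<otimes> x \<otimes> t) < len (s \<otimes> x) \<longleftrightarrow> len (x \<otimes> t) < len x"
    using ex by linarith+
qed

lemma hecke_commute:
  assumes "s \<in> S" "t \<in> S"
  shows "hecke_L s (hecke_R t \<rho>) = hecke_R t (hecke_L s \<rho>)"
proof
  fix x
  show "hecke_L s (hecke_R t \<rho>) x = hecke_R t (hecke_L s \<rho>) x"
  proof (cases "x \<in> carrier W")
    case True
    have a: "s \<otimes> (x \<otimes> t) = s \<otimes> x \<otimes> t" using assms True by (simp add: m_assoc)
    show ?thesis
    proof (cases "s \<otimes> x = x \<otimes> t")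
      case eq: True
      have "len (x \<otimes> t) \<noteq> len x" using len_gen_parity(1)[OF True assms(2)] by metis
      then show ?thesis using assms True a eq by (auto simp: hecke_R_def hecke_L_def)
    next
      case False
      show ?thesis
        using assms True a descents_independent[OF True assms False]
        by (simp add: hecke_R_def hecke_L_def algebra_simps)
    qed
  qed (simp add: hecke_R_def hecke_L_def)
qed

lemma hecke_R_scale: "hecke_R t (\<lambda>x. p * \<rho> x) = (\<lambda>x. p * hecke_R t \<rho> x)"
  by (auto simp: hecke_R_def algebra_simps)

lemma hecke_R_add: "hecke_R t (\<lambda>x. \<rho> x + \<sigma> x) = (\<lambda>x. hecke_R t \<rho> x + hecke_R t \<sigma> x)"
  by (auto simp: hecke_R_def algebra_simps)

lemma bar_R_scale: "bar_R t (\<lambda>x. p * \<rho> x) = (\<lambda>x. p * bar_R t \<rho> x)"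
  by (auto simp: bar_R_def hecke_R_scale algebra_simps)

lemma hecke_R_bar_L:
  assumes "s \<in> S" "t \<in> S"
  shows "hecke_R t (bar_L s \<rho>) = bar_L s (hecke_R t \<rho>)"
  using hecke_commute[OF assms, of \<rho>]
  by (auto simp: bar_L_def[abs_def] hecke_R_add hecke_R_scale)

lemma bar_commute:
  assumes "s \<in> S" "t \<in> S"
  shows "bar_R t (bar_L s \<rho>) = bar_L s (bar_R t \<rho>)"
proof -
  have "bar_L s (\<lambda>x. hecke_R t \<rho> x + (qq - 1) * \<rho> x) =
      (\<lambda>x. bar_L s (hecke_R t \<rho>) x + (qq - 1) * bar_L s \<rho> x)"
    by (auto simp: bar_L_def hecke_L_def algebra_simps)
  then show ?thesis
    by (auto simp: bar_R_def[abs_def] hecke_R_bar_L[OF assms])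
qed

lemma hecke_bar:
  assumes t: "t \<in> S" and supp: "supported \<rho>"
  shows "hecke_R t (bar_R t \<rho>) = (\<lambda>x. qq * \<rho> x)" "bar_R t (hecke_R t \<rho>) = (\<lambda>x. qq * \<rho> x)"
proof -
  have "hecke_R t (bar_R t \<rho>) x = qq * \<rho> x \<and> bar_R t (hecke_R t \<rho>) x = qq * \<rho> x" for x
  proof (cases "x \<in> carrier W")
    case True
    have "len (x \<otimes> t) \<noteq> len x" using len_gen_parity(1)[OF True t] by metis
    then consider "len (x \<otimes> t) < len x" | "len x < len (x \<otimes> t)" by linarith
    then show ?thesis
      by cases (use True t in \<open>simp_all add: hecke_R_def bar_R_def algebra_simps\<close>)
  qed (use supp in \<open>simp add: hecke_R_def bar_R_def supported_def\<close>)
  then show "hecke_R t (bar_R t \<rho>) = (\<lambda>x. qq * \<rho> x)" "bar_R t (hecke_R t \<rho>) = (\<lambda>x. qq * \<rho> x)"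
    by blast+
qed

lemma fold_hecke_bar:
  assumes "ws \<in> lists S" "supported \<rho>"
  shows "fold hecke_R (rev ws) (fold bar_R ws \<rho>) = (\<lambda>x. qq ^ length ws * \<rho> x)"
    and "fold bar_R ws (fold hecke_R (rev ws) \<rho>) = (\<lambda>x. qq ^ length ws * \<rho> x)"
proof -
  have scale: "fold bar_R us (\<lambda>x. p * \<sigma> x) = (\<lambda>x. p * fold bar_R us \<sigma> x)" for us p \<sigma>
    by (induction us arbitrary: \<sigma>) (simp_all add: bar_R_scale)
  have scale': "fold hecke_R us (\<lambda>x. p * \<sigma> x) = (\<lambda>x. p * fold hecke_R us \<sigma> x)" for us p \<sigma>
    by (induction us arbitrary: \<sigma>) (simp_all add: hecke_R_scale)
  show "fold hecke_R (rev ws) (fold bar_R ws \<rho>) = (\<lambda>x. qq ^ length ws * \<rho> x)"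
    using assms
  proof (induction ws rule: rev_induct)
    case (snoc s ws)
    then have "s \<in> S" "supported (fold bar_R ws \<rho>)" by (simp_all add: supported_fold_bar_R)
    then show ?case using snoc by (simp add: hecke_bar scale' mult.assoc)
  qed simp
  have supp: "supported (fold hecke_R us \<rho>)" for us
    using assms(2) by (induction us rule: rev_induct) (auto simp: supported_hecke_R)
  show "fold bar_R ws (fold hecke_R (rev ws) \<rho>) = (\<lambda>x. qq ^ length ws * \<rho> x)"
    using assms(1)
  proof (induction ws)
    case (Cons s ws)
    then show ?case by (simp add: hecke_bar[OF _ supp] scale mult.assoc)
  qed simp
qed

lemma fold_hecke_basis:
  assumes "ws \<in> lists S" "length ws = len (wprod ws)"
  shows "fold hecke_R ws (basis \<one>) = basis (wprod ws)"
  using assms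
proof (induction ws rule: rev_induct)
  case (snoc t ws)
  then have S: "t \<in> S" "ws \<in> lists S" by simp_all
  let ?z = "wprod ws"
  have z: "?z \<in> carrier W" "wprod (ws @ [t]) = ?z \<otimes> t" using S by (simp_all add: wprod_append)
  have red: "length ws = len ?z" "len ?z < len (?z \<otimes> t)"
    using len_le[OF S(2)] len_mult_gen_le(1)[OF z(1) S(1)] snoc.prems(2) z(2) by simp_all
  have step: "hecke_R t (basis ?z) x = basis (?z \<otimes> t) x" for x
  proof (cases "x \<in> carrier W")
    case True
    have "x \<otimes> t = ?z \<longleftrightarrow> x = ?z \<otimes> t" using True S(1) z(1) by (metis gen_cancel(1))
    moreover have "?z \<otimes> t \<noteq> ?z" using red(2) by auto
    ultimately show ?thesis using True red z(1) S(1) by (auto simp: hecke_R_def basis_def)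
  next
    case False
    then show ?thesis using z(1) S(1) by (auto simp: hecke_R_def basis_def)
  qed
  have "hecke_R t (basis ?z) = basis (?z \<otimes> t)" using step by blast
  then show ?case using snoc.IH[OF S(2) red(1)] z(2) by simp
qed simp

lemma bar_basis_one: "s \<in> S \<Longrightarrow> bar_R s (basis \<one>) = bar_L s (basis \<one>)"
proof
  fix x assume s: "s \<in> S"
  have "x \<otimes> s = \<one> \<longleftrightarrow> x = s" "s \<otimes> x = \<one> \<longleftrightarrow> x = s" if "x \<in> carrier W"
    using that s by (metis gen_inv inv_equality inv_inv S_carrier gen_square)+
  then show "bar_R s (basis \<one>) x = bar_L s (basis \<one>) x"
    using s by (auto simp: bar_R_def bar_L_def hecke_R_def hecke_L_def basis_def)
qed

text \<open>
  For a single letter, both sides are one operator applied to the unit; the rest is the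
  commutation of left and right operators.
\<close>
lemma bar_right_to_left:
  assumes "ws \<in> lists S"
  shows "fold bar_R ws (basis \<one>) = foldr bar_L ws (basis \<one>)"
  using assms
proof (induction ws rule: rev_induct)
  case (snoc s ws)
  then have S: "s \<in> S" "ws \<in> lists S" by simp_all
  have "bar_R s (foldr bar_L us \<rho>) = foldr bar_L us (bar_R s \<rho>)" if "us \<in> lists S" for us \<rho>
    using that by (induction us) (simp_all add: bar_commute[OF _ S(1)])
  then show ?case using snoc.IH[OF S(2)] S by (simp add: bar_basis_one)
qed simp

text \<open>
  The functions \<open>?A\<close> and \<open>?B\<close> below are compared after undoing \<open>as\<close> by the inverse operators.  On \<open>?B\<close>
  this has the same effect as undoing \<open>bs\<close>: written with left operators, \<open>?B\<close> lets both right
  products pass to the basis element of \<open>\<one>\<close>, which they send to the basis element of \<open>inv y\<close>.  This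
  replaces an appeal to the theorem of Matsumoto on the braid moves between reduced words.
\<close>
lemma fold_bar_reduced_unique:
  assumes a: "as \<in> lists S" "length as = len y" "wprod as = y"
    and b: "bs \<in> lists S" "length bs = len y" "wprod bs = y"
  shows "fold bar_R as (basis \<one>) = fold bar_R bs (basis \<one>)"
proof -
  let ?A = "fold bar_R as (basis \<one>)" and ?B = "fold bar_R bs (basis \<one>)"
  have y: "y \<in> carrier W" using a by auto
  have comm: "fold hecke_R us (foldr bar_L bs \<rho>) = foldr bar_L bs (fold hecke_R us \<rho>)"
    if "us \<in> lists S" for us \<rho>
  proof -
    have one: "hecke_R t (foldr bar_L cs \<sigma>) = foldr bar_L cs (hecke_R t \<sigma>)"
      if "t \<in> S" "cs \<in> lists S" for t cs \<sigma>
      using that(2) by (induction cs) (simp_all add: hecke_R_bar_L[OF _ that(1)])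
    show ?thesis
      using that by (induction us arbitrary: \<rho>) (simp_all add: one b(1))
  qed
  have inv_word: "fold hecke_R (rev cs) (basis \<one>) = basis (inv y)"
    if "cs \<in> lists S" "length cs = len y" "wprod cs = y" for cs
    using fold_hecke_basis[of "rev cs"] that y by (simp add: wprod_rev len_inv)
  have same: "fold hecke_R (rev as) ?B = fold hecke_R (rev bs) ?B"
    using comm[of "rev as" "basis \<one>"] comm[of "rev bs" "basis \<one>"] a b inv_word[OF a(1,2,3)]
      inv_word[OF b(1,2,3)] by (simp add: bar_right_to_left)
  also have "\<dots> = (\<lambda>x. qq ^ len y * basis \<one> x)"
    using fold_hecke_bar(1)[OF b(1) supported_basis[of \<one>]] b(2) by simp
  finally have "fold bar_R as (fold hecke_R (rev as) ?B) =
      fold bar_R as (\<lambda>x. qq ^ len y * basis \<one> x)" by simp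
  moreover have "fold bar_R us (\<lambda>x. p * \<sigma> x) = (\<lambda>x. p * fold bar_R us \<sigma> x)" for us p \<sigma>
    by (induction us arbitrary: \<sigma>) (simp_all add: bar_R_scale)
  moreover have "fold bar_R as (fold hecke_R (rev as) ?B) = (\<lambda>x. qq ^ len y * ?B x)"
    using fold_hecke_bar(2)[OF a(1), of ?B] supported_fold_bar_R supported_basis[of \<one>] a(2) by simp
  ultimately have eq: "(\<lambda>x. qq ^ len y * ?B x) = (\<lambda>x. qq ^ len y * ?A x)" by simp
  have "?A x = ?B x" for x using fun_cong[OF eq, of x] by simp
  then show ?thesis by blast
qed

definition reduced_R :: "'a \<Rightarrow> 'a \<Rightarrow> int poly" where
  "reduced_R x y = (if y \<in> carrier W then
     fold bar_R (SOME ws. ws \<in> lists S \<and> length ws = len y \<and> wprod ws = y) (basis \<one>) x else 0)"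

lemma reduced_R_word:
  assumes "ws \<in> lists S" "length ws = len y" "wprod ws = y"
  shows "reduced_R x y = fold bar_R ws (basis \<one>) x"
proof -
  let ?P = "\<lambda>ws. ws \<in> lists S \<and> length ws = len y \<and> wprod ws = y"
  have "?P (SOME ws. ?P ws)" by (rule someI[of ?P ws]) (use assms in simp)
  then have "fold bar_R (SOME ws. ?P ws) (basis \<one>) = fold bar_R ws (basis \<one>)"
    using fold_bar_reduced_unique assms by blast
  then show ?thesis using assms by (auto simp: reduced_R_def)
qed

lemma reduced_R_rec:
  assumes "y \<in> carrier W" "s \<in> S" "len (y \<otimes> s) < len y"
  shows "reduced_R x y = bar_R s (\<lambda>z. reduced_R z (y \<otimes> s)) x"
proof -
  obtain ws where ws: "ws \<in> lists S" "wprod ws = y \<otimes> s" "length ws = len (y \<otimes> s)"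
    using ex_reduced[of "y \<otimes> s"] assms by auto
  have "len y = Suc (len (y \<otimes> s))" using len_descent assms by blast
  then have "reduced_R x y = fold bar_R (ws @ [s]) (basis \<one>) x"
    using ws assms by (intro reduced_R_word) (auto simp: wprod_append)
  moreover have "(\<lambda>z. reduced_R z (y \<otimes> s)) = fold bar_R ws (basis \<one>)"
    using reduced_R_word[of ws "y \<otimes> s"] ws by auto
  ultimately show ?thesis by simp
qed

lemma reduced_R_one: "reduced_R x \<one> = basis \<one> x"
  using reduced_R_word[of "[]" \<one> x] by simp

lemma reduced_R_support:
  assumes "y \<in> carrier W"
  shows "(\<not> x \<preceq> y \<longrightarrow> reduced_R x y = 0) \<and> reduced_R y y = 1"
  using assms
proof (induction "len y" arbitrary: x y rule: less_induct)
  case less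
  show ?case
  proof (cases "y = \<one>")
    case True
    then show ?thesis by (auto simp: reduced_R_one basis_def)
  next
    case False
    then obtain s where s: "s \<in> S" "len y = Suc (len (y \<otimes> s))"
      by (rule ex_right_descent[OF less.prems])
    then have l: "len (y \<otimes> s) < len y" by simp
    have y: "y \<in> carrier W" "y \<otimes> s \<in> carrier W" using less.prems s by auto
    have IH: "\<not> z \<preceq> y \<otimes> s \<Longrightarrow> reduced_R z (y \<otimes> s) = 0" "reduced_R (y \<otimes> s) (y \<otimes> s) = 1" for z
      using less.hyps[OF l y(2)] by blast+
    have below: "z \<preceq> y" "z \<otimes> s \<preceq> y" if "z \<preceq> y \<otimes> s" for z
      using that le_gen_down[OF y(1) s(1) l] lift_right_descent[OF _ s(1) l] le_trans by blast+
    have "reduced_R x y = 0" if "\<not> x \<preceq> y"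
    proof -
      have "\<not> x \<preceq> y \<otimes> s" using below that by blast
      moreover have "\<not> x \<otimes> s \<preceq> y \<otimes> s" if "x \<in> carrier W"
        using below(2)[of "x \<otimes> s"] \<open>\<not> x \<preceq> y\<close> that s by auto
      ultimately show ?thesis
        using IH(1) reduced_R_rec[OF y(1) s(1) l, of x] by (simp add: bar_R_def hecke_R_def)
    qed
    moreover have "reduced_R y y = 1"
      using IH(2) reduced_R_rec[OF y(1) s(1) l, of y] y l by (simp add: bar_R_def hecke_R_def)
    ultimately show ?thesis by blast
  qed
qed

lemma reduced_R_family: "is_R_family W S reduced_R"
  unfolding is_R_family_def
proof (intro conjI allI ballI impI)
  fix x assume "x \<in> carrier W"
  then show "reduced_R x x = 1" using reduced_R_support by blast
next
  fix x y assume "\<not> x \<preceq> y"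
  then show "reduced_R x y = 0"
    using reduced_R_support by (cases "y \<in> carrier W") (auto simp: reduced_R_def)
next
  fix x y s assume *: "x \<in> carrier W" "y \<in> carrier W" "s \<in> S" "bruhat_less W S (y \<otimes> s) y"
  then have l: "len (y \<otimes> s) < len y" by (simp add: less_gen_iff)
  show "reduced_R x y = reduced_R (x \<otimes> s) (y \<otimes> s)" if "bruhat_less W S (x \<otimes> s) x"
    using that * reduced_R_rec[OF _ _ l, of x] by (simp add: less_gen_iff bar_R_def hecke_R_def)
  show "reduced_R x y = [:0, 1:] * reduced_R (x \<otimes> s) (y \<otimes> s) + ([:0, 1:] - 1) * reduced_R x (y \<otimes> s)"
    if "bruhat_less W S x (x \<otimes> s)"
  proof -
    have "\<not> len (x \<otimes> s) < len x" using that * by (simp add: less_gen_iff)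
    then show ?thesis
      using * reduced_R_rec[OF _ _ l, of x] unfolding bar_R_def hecke_R_def qq_def by simp
  qed
qed

lemma R_family_unique:
  assumes "is_R_family W S R" "is_R_family W S R'"
  shows "R = R'"
proof -
  have zero: "R x y = R' x y" if "\<not> x \<preceq> y" for x y
    using that assms unfolding is_R_family_def by metis
  have "R x y = R' x y" if "y \<in> carrier W" for x y
    using that
  proof (induction "len y" arbitrary: x y rule: less_induct)
    case less
    show ?case
    proof (cases "x \<preceq> y")
      case True
      then have x: "x \<in> carrier W" using le_carrier by blast
      show ?thesis
      proof (cases "y = \<one>")
        case True
        then have "x = y" using \<open>x \<preceq> y\<close> le_one by blast
        then show ?thesis using assms less.prems by (simp add: is_R_family_def)
      next
        case False
        then obtain s where s: "s \<in> S" "len y = Suc (len (y \<otimes> s))"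
          by (rule ex_right_descent[OF less.prems])
        then have l: "len (y \<otimes> s) < len y" "bruhat_less W S (y \<otimes> s) y"
          using less.prems by (simp_all add: less_gen_iff)
        have IH: "R z (y \<otimes> s) = R' z (y \<otimes> s)" for z
          using less.hyps[OF l(1)] less.prems s by simp
        consider "bruhat_less W S (x \<otimes> s) x" | "bruhat_less W S x (x \<otimes> s)"
          by (rule len_right_cases[OF x s(1)]) (use x s in \<open>simp_all add: less_gen_iff\<close>)
        then show ?thesis
        proof cases
          case 1
          have "R x y = R (x \<otimes> s) (y \<otimes> s)" "R' x y = R' (x \<otimes> s) (y \<otimes> s)"
            using assms 1 x s l less.prems unfolding is_R_family_def by blast+
          then show ?thesis using IH by simp
        next
          case 2
          have "Q x y = qq * Q (x \<otimes> s) (y \<otimes> s) + (qq - 1) * Q x (y \<otimes> s)"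
            if "is_R_family W S Q" for Q
            using that 2 x s l less.prems unfolding is_R_family_def qq_def by blast
          from this[OF assms(1)] this[OF assms(2)] show ?thesis using IH by simp
        qed
      qed
    qed (rule zero)
  qed
  moreover have "R x y = R' x y" if "y \<notin> carrier W" for x y
    using zero that le_carrier by blast
  ultimately show ?thesis by blast
qed

lemma R_poly_eq: "R_poly W S = reduced_R"
  unfolding R_poly_def using reduced_R_family R_family_unique by blast

abbreviation R :: "'a \<Rightarrow> 'a \<Rightarrow> int poly" where "R \<equiv> R_poly W S"

lemma R_refl: "x \<in> carrier W \<Longrightarrow> R x x = 1"
  using reduced_R_support by (simp add: R_poly_eq)

lemma R_zero: "\<not> x \<preceq> y \<Longrightarrow> R x y = 0"
  using reduced_R_family by (simp add: R_poly_eq is_R_family_def)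

lemma R_descent:
  assumes "x \<in> carrier W" "y \<in> carrier W" "s \<in> S" "len (y \<otimes> s) < len y" "len (x \<otimes> s) < len x"
  shows "R x y = R (x \<otimes> s) (y \<otimes> s)"
  using reduced_R_rec[of y s x] assms by (simp add: R_poly_eq bar_R_def hecke_R_def)

lemma R_ascent:
  assumes "x \<in> carrier W" "y \<in> carrier W" "s \<in> S" "len (y \<otimes> s) < len y" "len x < len (x \<otimes> s)"
  shows "R x y = qq * R (x \<otimes> s) (y \<otimes> s) + (qq - 1) * R x (y \<otimes> s)"
  using reduced_R_rec[of y s x] assms unfolding R_poly_eq bar_R_def hecke_R_def by simp

lemma coeff_R_ascent:
  assumes "x \<in> carrier W" "y \<in> carrier W" "s \<in> S" "len (y \<otimes> s) < len y" "len x < len (x \<otimes> s)"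
  shows "Polynomial.coeff (R x y) (Suc k) = Polynomial.coeff (R (x \<otimes> s) (y \<otimes> s)) k +
    Polynomial.coeff (R x (y \<otimes> s)) k - Polynomial.coeff (R x (y \<otimes> s)) (Suc k)"
  unfolding R_ascent[OF assms] by (simp add: qq_def left_diff_distrib)

lemma R_monic:
  assumes "x \<preceq> y"
  shows "Polynomial.coeff (R x y) (len y - len x) = 1 \<and>
    (\<forall>k > len y - len x. Polynomial.coeff (R x y) k = 0)"
  using assms
proof (induction "len y" arbitrary: x y rule: less_induct)
  case less
  have x: "x \<in> carrier W" and y: "y \<in> carrier W" using less.prems le_carrier by blast+
  show ?case
  proof (cases "x = y")
    case True
    then show ?thesis using R_refl[OF x] by simp
  next
    case False
    then have "len x < len y" using less.prems le_len by blast
    then have "y \<noteq> \<one>" by auto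
    then obtain s where s: "s \<in> S" "len y = Suc (len (y \<otimes> s))" by (rule ex_right_descent[OF y])
    then have l: "len (y \<otimes> s) < len y" by simp
    show ?thesis
    proof (cases rule: len_right_cases[OF x s(1)])
      case 1
      then have lx: "len x < len (x \<otimes> s)" by simp
      have xys: "x \<preceq> y \<otimes> s" by (rule lift_left_ascent[OF less.prems s(1) lx])
      have A: "Polynomial.coeff (R x (y \<otimes> s)) (len (y \<otimes> s) - len x) = 1"
        "\<And>k. k > len (y \<otimes> s) - len x \<Longrightarrow> Polynomial.coeff (R x (y \<otimes> s)) k = 0"
        using less.hyps[OF l xys] by blast+
      have B: "Polynomial.coeff (R (x \<otimes> s) (y \<otimes> s)) k = 0" if "k \<ge> len (y \<otimes> s) - len x" for k
      proof (cases "x \<otimes> s \<preceq> y \<otimes> s")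
        case True
        have "len x < len (y \<otimes> s)" using le_len[OF True] lx by auto
        then show ?thesis using less.hyps[OF l True] that 1 by simp
      qed (simp add: R_zero)
      have n: "len y - len x = Suc (len (y \<otimes> s) - len x)" using le_len[OF xys] s(2) by auto
      have rec: "Polynomial.coeff (R x y) (Suc k) = Polynomial.coeff (R (x \<otimes> s) (y \<otimes> s)) k +
        Polynomial.coeff (R x (y \<otimes> s)) k - Polynomial.coeff (R x (y \<otimes> s)) (Suc k)" for k
        using coeff_R_ascent x y s l lx by blast
      show ?thesis
      proof (intro conjI allI impI)
        show "Polynomial.coeff (R x y) (len y - len x) = 1" unfolding n rec using A B by simp
        fix k assume "len y - len x < k"
        then obtain j where "k = Suc j" "len (y \<otimes> s) - len x < j" using n by (cases k) auto
        then show "Polynomial.coeff (R x y) k = 0" using A(2)[of j] A(2)[of "Suc j"] B[of j] rec by simp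
      qed
    next
      case 2
      then have "R x y = R (x \<otimes> s) (y \<otimes> s)" using R_descent x y s by simp
      moreover have "x \<otimes> s \<preceq> y \<otimes> s" using lift_both_descent[OF less.prems s(1)] 2 by simp
      ultimately show ?thesis using less.hyps[OF l, of "x \<otimes> s"] 2 s(2) by simp
    qed
  qed
qed

abbreviation d :: "'a \<Rightarrow> 'a \<Rightarrow> int" where "d \<equiv> d_coeff W S"

lemma d_descent:
  assumes "x \<in> carrier W" "y \<in> carrier W" "s \<in> S" "len (y \<otimes> s) < len y" "len (x \<otimes> s) < len x"
  shows "d x y = d (x \<otimes> s) (y \<otimes> s)"
proof -
  have "len y = Suc (len (y \<otimes> s))" "len x = Suc (len (x \<otimes> s))"
    using len_descent assms by blast+
  then show ?thesis using R_descent[OF assms] by (simp add: d_coeff_def)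
qed

lemma d_simple_edge:
  assumes "x \<in> carrier W" "s \<in> S" "len x < len (x \<otimes> s)"
  shows "d x (x \<otimes> s) = 1"
proof -
  have "\<not> x \<otimes> s \<preceq> x" using le_len assms(3) by fastforce
  then have "R x (x \<otimes> s) = qq - 1"
    using R_ascent[of x "x \<otimes> s" s] assms by (simp add: R_zero R_refl)
  moreover have "len (x \<otimes> s) - len x - 1 = 0" using len_mult_gen_le(1)[OF assms(1,2)] by simp
  ultimately show ?thesis unfolding d_coeff_def qq_def by simp
qed

text \<open>
  In the coefficient that defines \<open>d\<close>, the factor \<open>q - 1\<close> contributes \<open>d x (y s)\<close> and the leading
  coefficient of the second polynomial, and the first polynomial contributes its leading
  coefficient if it does not vanish.
\<close>
lemma d_ascent:
  assumes x: "x \<in> carrier W" and y: "y \<in> carrier W" and s: "s \<in> S"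
    and ly: "len (y \<otimes> s) < len y" and lx: "len x < len (x \<otimes> s)"
    and xy: "x \<preceq> y \<otimes> s" "x \<noteq> y \<otimes> s"
  shows "d x y = d x (y \<otimes> s) + (if x \<otimes> s \<preceq> y \<otimes> s then 0 else 1)"
proof -
  have "len x < len (y \<otimes> s)" using le_len[OF xy(1)] xy(2) by blast
  then obtain k where k: "len (y \<otimes> s) - len x = Suc k" by (metis Suc_diff_Suc)
  have "len y = Suc (len (y \<otimes> s))" using len_descent[OF y s ly] .
  then have ky: "len y - len x = Suc (Suc k)" using k by linarith
  have "len (x \<otimes> s) = Suc (len x)" using len_ascent[OF x s lx] .
  then have kx: "len (y \<otimes> s) - len (x \<otimes> s) = k" using k by simp
  have "Polynomial.coeff (R (x \<otimes> s) (y \<otimes> s)) k = (if x \<otimes> s \<preceq> y \<otimes> s then 1 else 0)"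
    using R_monic[of "x \<otimes> s" "y \<otimes> s"] kx by (auto simp: R_zero)
  moreover have "Polynomial.coeff (R x (y \<otimes> s)) (Suc k) = 1" using R_monic[OF xy(1)] k by simp
  ultimately show ?thesis
    using coeff_R_ascent[OF x y s ly lx, of k] k ky by (simp add: d_coeff_def)
qed

end

section \<open>Underdetermined homogeneous systems\<close>

text \<open>
  Gaussian elimination: the equation \<open>e\<close> is solved for an unknown \<open>j\<close> that occurs in it, and this
  unknown is eliminated from the other equations.
\<close>
lemma homogeneous_system_nontrivial:
  fixes a :: "'i \<Rightarrow> 'e \<Rightarrow> real"
  assumes "finite F" "finite I" "card F < card I"
  shows "\<exists>c. (\<forall>e\<in>F. (\<Sum>i\<in>I. c i * a i e) = 0) \<and> (\<exists>i\<in>I. c i \<noteq> 0)"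
  using assms
proof (induction F arbitrary: I a rule: finite_induct)
  case empty
  then have "I \<noteq> {}" by auto
  then show ?case by (intro exI[of _ "\<lambda>_. 1"]) auto
next
  case (insert e F)
  show ?case
  proof (cases "\<forall>i\<in>I. a i e = 0")
    case True
    have "card F < card I" using insert by simp
    from insert.IH[OF insert.prems(1) this, of a] show ?thesis using True by auto
  next
    case False
    then obtain j where j: "j \<in> I" "a j e \<noteq> 0" by blast
    define J where "J = I - {j}"
    have J: "finite J" "card F < card J" "j \<notin> J" "I = insert j J"
      using insert j by (auto simp: J_def)
    obtain c where c: "\<forall>f\<in>F. (\<Sum>i\<in>J. c i * (a i f - a i e / a j e * a j f)) = 0"
      and nz: "\<exists>i\<in>J. c i \<noteq> 0"
      using insert.IH[OF J(1,2), of "\<lambda>i f. a i f - a i e / a j e * a j f"] by blast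
    define b where "b = - (\<Sum>i\<in>J. c i * a i e) / a j e"
    define c' where "c' = c(j := b)"
    have sum: "(\<Sum>i\<in>I. c' i * a i f) = b * a j f + (\<Sum>i\<in>J. c i * a i f)" for f
      using J by (auto simp: c'_def intro!: sum.cong)
    have "(\<Sum>i\<in>J. c i * (a i f - a i e / a j e * a j f)) =
        (\<Sum>i\<in>J. c i * a i f) - (\<Sum>i\<in>J. c i * a i e) / a j e * a j f" for f
      by (simp add: right_diff_distrib sum_subtractf sum_distrib_right sum_divide_distrib mult.assoc)
    then have "(\<Sum>i\<in>J. c i * a i f) = (\<Sum>i\<in>J. c i * a i e) / a j e * a j f" if "f \<in> F" for f
      using c that by fastforce
    then have "(\<Sum>i\<in>I. c' i * a i f) = 0" if "f \<in> F" for f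
      unfolding sum b_def using that by simp
    moreover have "(\<Sum>i\<in>I. c' i * a i e) = 0"
      unfolding sum b_def using j by simp
    moreover have "\<exists>i\<in>I. c' i \<noteq> 0" using nz J by (auto simp: c'_def)
    ultimately show ?thesis by (intro exI[of _ c']) auto
  qed
qed

context coxeter_system
begin

section \<open>Sections over Bruhat intervals\<close>

text \<open>
  Every edge \<open>z - z t\<close> of the Bruhat graph is also an edge \<open>z - r z\<close> with \<open>r = z t z\<^sup>-\<^sup>1\<close>.  In this form
  the label \<open>r\<close> is unchanged when the edge is multiplied by \<open>s\<close> on the right, which is what makes
  invariant extensions possible.
\<close>
definition is_section :: "'a set \<Rightarrow> ('a \<Rightarrow> 'a \<Rightarrow>\<^sub>0 real) \<Rightarrow> bool" where
  "is_section A f \<longleftrightarrow> (\<forall>r \<gamma> z. root_of r \<gamma> \<longrightarrow> z \<in> A \<longrightarrow> r \<otimes> z \<in> A \<longrightarrow>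
     (\<exists>c. f (r \<otimes> z) = f z + c *\<^sub>R \<gamma>))"

lemma is_sectionD:
  assumes "is_section A f" "root_of r \<gamma>" "z \<in> A" "r \<otimes> z \<in> A"
  obtains c where "f (r \<otimes> z) = f z + c *\<^sub>R \<gamma>"
  using assms unfolding is_section_def by blast

lemma is_section_subset: "is_section B f \<Longrightarrow> A \<subseteq> B \<Longrightarrow> is_section A f"
  unfolding is_section_def by blast

lemma is_section_add:
  assumes "is_section A f" "is_section A g" shows "is_section A (\<lambda>z. f z + g z)"
  unfolding is_section_def
proof (intro allI impI)
  fix r \<gamma> z assume *: "root_of r \<gamma>" "z \<in> A" "r \<otimes> z \<in> A"
  obtain a where "f (r \<otimes> z) = f z + a *\<^sub>R \<gamma>" using is_sectionD[OF assms(1) *] .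
  moreover obtain b where "g (r \<otimes> z) = g z + b *\<^sub>R \<gamma>" using is_sectionD[OF assms(2) *] .
  ultimately show "\<exists>c. f (r \<otimes> z) + g (r \<otimes> z) = f z + g z + c *\<^sub>R \<gamma>"
    by (intro exI[of _ "a + b"]) (simp add: scaleR_add_left)
qed

lemma is_section_scale:
  assumes "is_section A f" shows "is_section A (\<lambda>z. c *\<^sub>R f z)"
  unfolding is_section_def
proof (intro allI impI)
  fix r \<gamma> z assume *: "root_of r \<gamma>" "z \<in> A" "r \<otimes> z \<in> A"
  obtain a where "f (r \<otimes> z) = f z + a *\<^sub>R \<gamma>" using is_sectionD[OF assms *] .
  then show "\<exists>b. c *\<^sub>R f (r \<otimes> z) = c *\<^sub>R f z + b *\<^sub>R \<gamma>"
    by (intro exI[of _ "c * a"]) (simp add: scaleR_add_right)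
qed

lemma is_section_zero: "is_section A (\<lambda>z. 0)"
  unfolding is_section_def by (auto intro: exI[of _ 0])

lemma is_section_sum:
  fixes f :: "nat \<Rightarrow> 'a \<Rightarrow> 'a \<Rightarrow>\<^sub>0 real"
  assumes "\<And>i. i < k \<Longrightarrow> is_section A (f i)"
  shows "is_section A (\<lambda>z. \<Sum>i<k. c i *\<^sub>R f i z)"
  using assms
  by (induction k) (simp_all add: is_section_zero is_section_add is_section_scale)

lemma is_section_act:
  assumes "A \<subseteq> carrier W" shows "is_section A (\<lambda>z. act z v)"
  unfolding is_section_def
proof (intro allI impI)
  fix r \<gamma> z assume r: "root_of r \<gamma>" and z: "z \<in> A"
  obtain c where "act r (act z v) = act z v + c *\<^sub>R \<gamma>" using act_root_of[OF r] .
  then have "act (r \<otimes> z) v = act z v + c *\<^sub>R \<gamma>"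
    using act_mult root_of_carrier[OF r] z assms by auto
  then show "\<exists>c. act (r \<otimes> z) v = act z v + c *\<^sub>R \<gamma>" ..
qed

lemma root_of_right_edge:
  "z \<in> carrier W \<Longrightarrow> s \<in> S \<Longrightarrow> root_of (z \<otimes> s \<otimes> inv z) (act z (simple_root s))"
  using root_of_conj root_of_simple by blast

lemma right_edge: "z \<in> carrier W \<Longrightarrow> t \<in> carrier W \<Longrightarrow> z \<otimes> t \<otimes> inv z \<otimes> z = z \<otimes> t"
  by (simp add: m_assoc)

lemma section_right_edge:
  assumes "is_section A f" "A \<subseteq> carrier W" "s \<in> S" "z \<in> A" "z \<otimes> s \<in> A"
  obtains c where "f (z \<otimes> s) = f z + c *\<^sub>R act z (simple_root s)"
proof -
  have z: "z \<in> carrier W" using assms by blast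
  have eq: "z \<otimes> s \<otimes> inv z \<otimes> z = z \<otimes> s" using right_edge[OF z S_carrier[OF assms(3)]] .
  have "z \<otimes> s \<otimes> inv z \<otimes> z \<in> A" unfolding eq by (rule assms(5))
  then obtain c where "f (z \<otimes> s \<otimes> inv z \<otimes> z) = f z + c *\<^sub>R act z (simple_root s)"
    by (rule is_sectionD[OF assms(1) root_of_right_edge[OF z assms(3)] assms(4)])
  then show thesis unfolding eq by (rule that)
qed

lemma roots_independent:
  assumes "root_of r \<gamma>" "root_of t \<beta>" "r \<noteq> t" "a *\<^sub>R \<gamma> = b *\<^sub>R \<beta>"
  shows "a = 0" "b = 0"
proof -
  have "False" if "a \<noteq> 0"
  proof -
    have "\<gamma> = (1 / a) *\<^sub>R (a *\<^sub>R \<gamma>)" using that by simp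
    also have "\<dots> = (b / a) *\<^sub>R \<beta>" unfolding assms(4) by simp
    finally have "root_of r ((b / a) *\<^sub>R \<beta>)" using assms(1) by simp
    then show False using root_of_multiple[OF assms(2)] assms(3) by blast
  qed
  then show "a = 0" by blast
  then show "b = 0" using assms root_of_nonzero by auto
qed

text \<open>
  Go around the quadrangle \<open>z, z s, r z s, r z\<close>.  Two opposite edges have the label \<open>r\<close>, and modulo the
  root of \<open>r\<close> the other two have the same root, so comparing the changes of \<open>f\<close> modulo the root of
  \<open>r\<close> compares the two slopes.
\<close>
lemma section_slope_edge:
  assumes f: "is_section A f" and A: "A \<subseteq> carrier W" and s: "s \<in> S"
    and r: "r \<in> reflections W S"
    and z: "z \<in> A" "z \<otimes> s \<in> A" "r \<otimes> z \<in> A" "r \<otimes> z \<otimes> s \<in> A"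
    and c: "f (z \<otimes> s) = f z + c *\<^sub>R act z (simple_root s)"
  shows "f (r \<otimes> z \<otimes> s) = f (r \<otimes> z) + c *\<^sub>R act (r \<otimes> z) (simple_root s)"
proof -
  have zW: "z \<in> carrier W" and rW: "r \<in> carrier W" using A z r reflections_carrier by blast+
  have sW: "s \<in> carrier W" using s by blast
  let ?\<beta> = "act z (simple_root s)"
  have \<beta>: "root_of (z \<otimes> s \<otimes> inv z) ?\<beta>" using root_of_right_edge[OF zW s] .
  show ?thesis
  proof (cases "r = z \<otimes> s \<otimes> inv z")
    case True
    then have rz: "r \<otimes> z = z \<otimes> s" using right_edge[OF zW sW] by simp
    then show ?thesis using c zW s by (simp add: act_mult act_gen)
  next
    case False
    obtain \<gamma> where \<gamma>: "root_of r \<gamma>" using reflection_root[OF r] .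
    obtain c' where c': "f (r \<otimes> z \<otimes> s) = f (r \<otimes> z) + c' *\<^sub>R act (r \<otimes> z) (simple_root s)"
      using section_right_edge[OF f A s z(3,4)] .
    obtain e where e: "f (r \<otimes> z) = f z + e *\<^sub>R \<gamma>" using is_sectionD[OF f \<gamma> z(1,3)] .
    have rzs: "r \<otimes> (z \<otimes> s) = r \<otimes> z \<otimes> s" using rW zW sW by (simp add: m_assoc)
    have "r \<otimes> (z \<otimes> s) \<in> A" unfolding rzs by (rule z(4))
    then obtain e' where "f (r \<otimes> (z \<otimes> s)) = f (z \<otimes> s) + e' *\<^sub>R \<gamma>" by (rule is_sectionD[OF f \<gamma> z(2)])
    then have e': "f (r \<otimes> z \<otimes> s) = f (z \<otimes> s) + e' *\<^sub>R \<gamma>" unfolding rzs .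
    obtain g where g: "act r ?\<beta> = ?\<beta> + g *\<^sub>R \<gamma>" using act_root_of[OF \<gamma>] .
    have "f z + e *\<^sub>R \<gamma> + c' *\<^sub>R (?\<beta> + g *\<^sub>R \<gamma>) = f z + c *\<^sub>R ?\<beta> + e' *\<^sub>R \<gamma>"
      using c c' e e' g rW zW by (simp add: act_mult)
    then have "(c' - c) *\<^sub>R ?\<beta> = (e' - e - c' * g) *\<^sub>R \<gamma>" by (simp add: algebra_simps)
    then have "c' = c" using roots_independent(1)[OF \<beta> \<gamma>] False by fastforce
    then show ?thesis using c' by simp
  qed
qed

lemma interval_carrier: "interval x y \<subseteq> carrier W"
  unfolding bruhat_interval_def using le_carrier by blast

text \<open>
  The setting in which intervals are compared: \<open>s\<close> is an ascent of the bottom and a descent of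
  the top, so that the interval is stable under right multiplication by \<open>s\<close>.
\<close>
context
  fixes x y s
  assumes s: "s \<in> S" and xy: "x \<preceq> y"
    and lx: "len x < len (x \<otimes> s)" and ly: "len (y \<otimes> s) < len y"
begin

lemma carriers: "x \<in> carrier W" "y \<in> carrier W" "s \<in> carrier W"
  using xy le_carrier s by blast+

lemma interval_stable: "z \<in> interval x y \<Longrightarrow> z \<otimes> s \<in> interval x y"
  unfolding bruhat_interval_def
  using lift_left_ascent[OF _ s lx] lift_right_descent[OF _ s ly] by blast

lemma lower_interval_iff:
  "z \<in> interval x (y \<otimes> s) \<longleftrightarrow> z \<in> interval x y \<and> z \<preceq> y \<otimes> s"
  unfolding bruhat_interval_def using le_gen_down[OF carriers(2) s ly] le_trans by blast

lemma lower_interval_subset: "interval x (y \<otimes> s) \<subseteq> interval x y"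
  using lower_interval_iff by blast

lemma ascent_in_lower:
  assumes "z \<in> interval x y" "len z < len (z \<otimes> s)" shows "z \<in> interval x (y \<otimes> s)"
  using lift_left_ascent[OF _ s assms(2)] assms(1) lower_interval_iff
  unfolding bruhat_interval_def by blast

lemma not_lower_shift:
  assumes "z \<in> interval x y" "z \<notin> interval x (y \<otimes> s)"
  shows "z \<otimes> s \<in> interval x (y \<otimes> s)"
proof (rule ascent_in_lower)
  have z: "z \<in> carrier W" using assms interval_carrier by blast
  show "z \<otimes> s \<in> interval x y" using interval_stable assms by blast
  have "\<not> len z < len (z \<otimes> s)" using ascent_in_lower assms by blast
  then show "len (z \<otimes> s) < len (z \<otimes> s \<otimes> s)"
    using z s len_gen_parity(1)[OF z s] by (metis gen_cancel(1) linorder_neqE_nat)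
qed

text \<open>
  Let \<open>w\<close> in the lower interval \<open>[x, y s]\<close> be adjacent to a vertex \<open>u\<close> outside.  The edge goes up to
  \<open>u\<close>, as everything between \<open>x\<close> and \<open>w\<close> is in the lower interval.  If \<open>u\<close> is not \<open>w s\<close>, then
  right multiplication by \<open>s\<close> carries this edge to one from \<open>w s\<close> up to \<open>u s\<close>, which is in the lower
  interval, so \<open>w s\<close> is in it too.
\<close>
lemma edge_cases:
  assumes r: "r \<in> reflections W S" and z: "z \<in> interval x y" "r \<otimes> z \<in> interval x y"
  shows "(z \<in> interval x (y \<otimes> s) \<and> r \<otimes> z \<in> interval x (y \<otimes> s)) \<or>
    (z \<otimes> s \<in> interval x (y \<otimes> s) \<and> r \<otimes> z \<otimes> s \<in> interval x (y \<otimes> s)) \<or> r \<otimes> z = z \<otimes> s"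
proof -
  let ?A = "interval x (y \<otimes> s)"
  have rW: "r \<in> carrier W" using r reflections_carrier by blast
  have mixed: "w \<otimes> s \<in> ?A \<or> u = w \<otimes> s"
    if w: "w \<in> ?A" and u: "u \<in> interval x y" "u \<notin> ?A" and adj: "w = q \<otimes> u" and q: "q \<in> reflections W S"
    for w u q
  proof (rule ccontr)
    assume neg: "\<not> (w \<otimes> s \<in> ?A \<or> u = w \<otimes> s)"
    have qW: "q \<in> carrier W" using q reflections_carrier by blast
    have uW: "u \<in> carrier W" and wW: "w \<in> carrier W" using u w interval_carrier by blast+
    have wB: "w \<in> interval x y" using w lower_interval_subset by blast
    have usA: "u \<otimes> s \<in> ?A" using not_lower_shift u by blast
    have u_eq: "u = w \<otimes> (inv w \<otimes> q \<otimes> w)"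
    proof -
      have "q \<otimes> w = q \<otimes> q \<otimes> u" unfolding adj using qW uW by (simp add: m_assoc)
      then show ?thesis using qW uW wW q by (simp add: m_assoc)
    qed
    define p where "p = inv w \<otimes> q \<otimes> w"
    have p: "p \<in> reflections W S" using reflections_conj[OF q, of "inv w"] wW by (simp add: p_def)
    have pW: "p \<in> carrier W" using reflections_carrier[OF p] .
    have u_p: "u = w \<otimes> p" using u_eq by (simp add: p_def)
    then have w_p: "w = u \<otimes> p" using p pW wW by (simp add: m_assoc)
    have "step w u" if "len w < len u" unfolding bruhat_step_def using that u_p p wW by blast
    moreover have "step u w" if "len u < len w" unfolding bruhat_step_def using that w_p p uW by blast
    ultimately have "step w u \<or> step u w \<or> len w = len u" by linarith
    moreover have False if "step u w"
      using step_le[OF that] w u le_trans lower_interval_iff by blast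
    moreover have False if "step w u"
    proof -
      have "step (w \<otimes> s) (u \<otimes> s)" using step_mult_gen[OF that s] neg by blast
      then have "w \<otimes> s \<preceq> y \<otimes> s" using usA step_le le_trans lower_interval_iff by blast
      then show False using neg interval_stable[OF wB] lower_interval_iff by blast
    qed
    moreover have "len w \<noteq> len u"
    proof -
      obtain \<beta> where \<beta>: "root_of p \<beta>" "nonneg \<beta>" using reflection_root[OF p] .
      then show ?thesis
        using len_reflection_neg[OF wW \<beta>] len_reflection_pos[OF wW \<beta>]
          root_of_pos_or_neg[OF root_of_conj[OF \<beta>(1) wW]] unfolding u_p by linarith
    qed
    ultimately show False by blast
  qed
  have zW: "z \<in> carrier W" "r \<otimes> z \<in> carrier W" using z interval_carrier by blast+
  have invol: "z = r \<otimes> (r \<otimes> z)" using r rW zW(1) by (simp flip: m_assoc)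
  consider "z \<in> ?A" "r \<otimes> z \<in> ?A" | "z \<in> ?A" "r \<otimes> z \<notin> ?A" | "z \<notin> ?A" "r \<otimes> z \<in> ?A"
    | "z \<notin> ?A" "r \<otimes> z \<notin> ?A" by blast
  then show ?thesis
  proof cases
    case 2
    then have "z \<otimes> s \<in> ?A \<or> r \<otimes> z = z \<otimes> s" using mixed[OF _ z(2) _ invol r] by blast
    then show ?thesis using not_lower_shift[OF z(2)] 2 by blast
  next
    case 3
    then have "r \<otimes> z \<otimes> s \<in> ?A \<or> z = r \<otimes> z \<otimes> s" using mixed[OF _ z(1) _ refl r] by blast
    moreover have "r \<otimes> z = z \<otimes> s" if "z = r \<otimes> z \<otimes> s"
      using gen_cancel(1)[OF s zW(2)] that by simp
    ultimately show ?thesis using not_lower_shift[OF z(1)] 3 by blast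
  next
    case 4
    then show ?thesis using not_lower_shift z by blast
  qed simp
qed

text \<open>
  Adding \<open>(c / 2) *\<^sub>R act z (simple_root s)\<close> makes \<open>f\<close> invariant under \<open>s\<close> wherever this can be
  tested on the lower interval; the invariant section extends by invariance, and the correction
  extends to all of \<open>W\<close>.
\<close>
lemma section_extend:
  assumes f: "is_section (interval x (y \<otimes> s)) f"
    and c: "\<And>z. z \<in> interval x (y \<otimes> s) \<Longrightarrow> z \<otimes> s \<in> interval x (y \<otimes> s) \<Longrightarrow>
      f (z \<otimes> s) = f z + c *\<^sub>R act z (simple_root s)"
  obtains F where "is_section (interval x y) F" "\<And>z. z \<in> interval x (y \<otimes> s) \<Longrightarrow> F z = f z"
    "\<And>z. z \<in> interval x y \<Longrightarrow> F (z \<otimes> s) = F z + c *\<^sub>R act z (simple_root s)"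
proof -
  let ?A = "interval x (y \<otimes> s)" and ?B = "interval x y"
  define g where "g z = f z + (c / 2) *\<^sub>R act z (simple_root s)" for z
  define G where "G z = (if z \<in> ?A then g z else g (z \<otimes> s))" for z
  define F where "F z = G z + (- c / 2) *\<^sub>R act z (simple_root s)" for z
  have AW: "?A \<subseteq> carrier W" and BW: "?B \<subseteq> carrier W" by (rule interval_carrier)+
  have g: "is_section ?A g"
    unfolding g_def[abs_def] using f AW by (intro is_section_add is_section_scale is_section_act)
  have flip: "act (z \<otimes> s) (simple_root s) = - act z (simple_root s)" if "z \<in> carrier W" for z
    using that s by (simp add: act_mult act_gen)
  have g_inv: "g (z \<otimes> s) = g z" if "z \<in> ?A" "z \<otimes> s \<in> ?A" for z
  proof -
    have z: "z \<in> carrier W" using that AW by blast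
    have "c *\<^sub>R v = (c / 2) *\<^sub>R v + (c / 2) *\<^sub>R v" for v :: "'a \<Rightarrow>\<^sub>0 real"
      by (simp flip: scaleR_add_left)
    then show ?thesis using c[OF that] flip[OF z] by (simp add: g_def)
  qed
  have G_inv: "G (z \<otimes> s) = G z" if "z \<in> ?B" for z
  proof -
    have "z \<otimes> s \<otimes> s = z" using that BW s by auto
    then show ?thesis
      using g_inv[of z] not_lower_shift[OF that] by (auto simp: G_def)
  qed
  have "is_section ?B G"
    unfolding is_section_def
  proof (intro allI impI)
    fix r \<gamma> z assume r: "root_of r \<gamma>" and z: "z \<in> ?B" "r \<otimes> z \<in> ?B"
    have zW: "z \<in> carrier W" and rW: "r \<in> carrier W" using z BW root_of_carrier[OF r] by blast+
    consider "z \<in> ?A" "r \<otimes> z \<in> ?A" | "z \<otimes> s \<in> ?A" "r \<otimes> z \<otimes> s \<in> ?A" | "r \<otimes> z = z \<otimes> s"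
      using edge_cases[OF root_of_reflection[OF r] z] by blast
    then show "\<exists>c. G (r \<otimes> z) = G z + c *\<^sub>R \<gamma>"
    proof cases
      case 1
      then show ?thesis using g r unfolding is_section_def G_def by simp
    next
      case 2
      have "r \<otimes> (z \<otimes> s) = r \<otimes> z \<otimes> s" using zW rW s by (simp add: m_assoc)
      then have "r \<otimes> (z \<otimes> s) \<in> ?A" using 2 by simp
      then have "\<exists>c. g (r \<otimes> (z \<otimes> s)) = g (z \<otimes> s) + c *\<^sub>R \<gamma>"
        using g r 2 unfolding is_section_def by blast
      then have "\<exists>c. G (r \<otimes> z \<otimes> s) = G (z \<otimes> s) + c *\<^sub>R \<gamma>"
        unfolding \<open>r \<otimes> (z \<otimes> s) = r \<otimes> z \<otimes> s\<close> using 2 by (simp add: G_def)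
      then show ?thesis using G_inv z by simp
    next
      case 3
      then show ?thesis using G_inv z by (intro exI[of _ 0]) simp
    qed
  qed
  then have "is_section ?B F"
    unfolding F_def[abs_def] using BW by (intro is_section_add is_section_scale is_section_act)
  moreover have "F z = f z" if "z \<in> ?A" for z
    using that by (simp add: F_def G_def g_def)
  moreover have slope: "F (z \<otimes> s) = F z + c *\<^sub>R act z (simple_root s)" if "z \<in> ?B" for z
  proof -
    have "c *\<^sub>R v = (c / 2) *\<^sub>R v + (c / 2) *\<^sub>R v" for v :: "'a \<Rightarrow>\<^sub>0 real"
      by (simp flip: scaleR_add_left)
    then show ?thesis using flip[of z] that BW G_inv[OF that] by (auto simp: F_def)
  qed
  ultimately show thesis using that by blast
qed

text \<open>
  If \<open>x s\<close> lies in the lower interval, the \<open>s\<close>-slope of a section is constant: every \<open>s\<close>-edge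
  is connected to the one at \<open>x s\<close> by a chain of edges that stay in the lower interval
  together with their \<open>s\<close>-translates.
\<close>
lemma section_slope_constant:
  assumes f: "is_section (interval x (y \<otimes> s)) f" and xs: "x \<otimes> s \<preceq> y \<otimes> s"
  obtains c where "\<And>z. z \<in> interval x (y \<otimes> s) \<Longrightarrow> z \<otimes> s \<in> interval x (y \<otimes> s) \<Longrightarrow>
      f (z \<otimes> s) = f z + c *\<^sub>R act z (simple_root s)"
proof -
  let ?A = "interval x (y \<otimes> s)"
  have AW: "?A \<subseteq> carrier W" by (rule interval_carrier)
  have x_xs: "x \<preceq> x \<otimes> s" using le_gen_up[OF carriers(1) s lx] .
  have xs_in: "x \<otimes> s \<in> ?A" "x \<otimes> s \<otimes> s \<in> ?A"
    using xs x_xs le_trans carriers s unfolding bruhat_interval_def by auto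
  obtain c where c: "f (x \<otimes> s \<otimes> s) = f (x \<otimes> s) + c *\<^sub>R act (x \<otimes> s) (simple_root s)"
    using section_right_edge[OF f AW s xs_in] .
  have above: "f (z \<otimes> s) = f z + c *\<^sub>R act z (simple_root s)"
    if "x \<otimes> s \<preceq> z" "z \<preceq> y \<otimes> s" "z \<otimes> s \<preceq> y \<otimes> s" for z
    using that
  proof (induction rule: le_induct)
    case refl
    show ?case by (rule c)
  next
    case (step u v)
    have uv: "u \<preceq> v" using step step_le by blast
    have u: "u \<preceq> y \<otimes> s" using uv step le_trans by blast
    have us: "u \<otimes> s \<preceq> y \<otimes> s" using lifting_up[OF uv s] step le_trans by blast
    have IH: "f (u \<otimes> s) = f u + c *\<^sub>R act u (simple_root s)" using step.IH u us by blast
    have in_A: "w \<in> ?A \<and> w \<otimes> s \<in> ?A" if "x \<otimes> s \<preceq> w" "w \<preceq> y \<otimes> s" "w \<otimes> s \<preceq> y \<otimes> s" for w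
      using that x_xs le_trans lift_left_ascent[OF _ s lx] unfolding bruhat_interval_def by blast
    have uA: "u \<in> ?A" "u \<otimes> s \<in> ?A" using in_A step.hyps u us by blast+
    have "x \<otimes> s \<preceq> v" using step.hyps uv le_trans by blast
    then have vA: "v \<in> ?A" "v \<otimes> s \<in> ?A" using in_A step.prems by blast+
    obtain t where t: "t \<in> reflections W S" "v = u \<otimes> t"
      using step.hyps unfolding bruhat_step_def by blast
    have uW: "u \<in> carrier W" and tW: "t \<in> carrier W" using uA AW t reflections_carrier by blast+
    have "u \<otimes> t \<otimes> inv u \<otimes> u = v" using right_edge[OF uW tW] t by simp
    then show ?case
      using section_slope_edge[OF f AW s reflections_conj[OF t(1) uW] uA _ _ IH] vA by simp
  qed
  have slope: "f (z \<otimes> s) = f z + c *\<^sub>R act z (simple_root s)" if z: "z \<in> ?A" "z \<otimes> s \<in> ?A" for z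
  proof -
    have zW: "z \<in> carrier W" using z AW by blast
    have le: "x \<preceq> z" "z \<preceq> y \<otimes> s" "z \<otimes> s \<preceq> y \<otimes> s" using z unfolding bruhat_interval_def by auto
    show ?thesis
    proof (cases "x \<otimes> s \<preceq> z")
      case True
      then show ?thesis using above le by blast
    next
      case False
      then have "x \<otimes> s \<preceq> z \<otimes> s" using lifting_up[OF le(1) s] by blast
      then have "f (z \<otimes> s \<otimes> s) = f (z \<otimes> s) + c *\<^sub>R act (z \<otimes> s) (simple_root s)"
        using above[of "z \<otimes> s"] le zW s by simp
      then show ?thesis using zW s by (simp add: act_mult act_gen)
    qed
  qed
  show thesis by (rule that[OF slope])
qed

text \<open>
  If \<open>x s\<close> is not below \<open>y s\<close>, then the lower interval contains no \<open>s\<close>-edge, and every slope is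
  possible.  Slope \<open>0\<close> makes the extension invariant under \<open>s\<close>.
\<close>
lemma section_extend_ex:
  assumes f: "is_section (interval x (y \<otimes> s)) f"
  obtains F c where "is_section (interval x y) F" "\<And>z. z \<in> interval x (y \<otimes> s) \<Longrightarrow> F z = f z"
    "\<And>z. z \<in> interval x y \<Longrightarrow> F (z \<otimes> s) = F z + c *\<^sub>R act z (simple_root s)"
    "x \<otimes> s \<preceq> y \<otimes> s \<or> c = 0"
proof (cases "x \<otimes> s \<preceq> y \<otimes> s")
  case True
  obtain c where c: "\<And>z. z \<in> interval x (y \<otimes> s) \<Longrightarrow> z \<otimes> s \<in> interval x (y \<otimes> s) \<Longrightarrow>
      f (z \<otimes> s) = f z + c *\<^sub>R act z (simple_root s)"
    by (rule section_slope_constant[OF f True]) blast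
  show thesis
    by (rule section_extend[OF f c]) (use that True in blast)+
next
  case False
  have none: "z \<otimes> s \<notin> interval x (y \<otimes> s)" if "z \<in> interval x (y \<otimes> s)" for z
    using lifting_up[of x z s] that s False le_trans unfolding bruhat_interval_def by blast
  show thesis
    by (rule section_extend[OF f, of 0]) (use none that in blast)+
qed

end


text \<open>
  The space of sections modulo constants has dimension at least \<open>k\<close>.
\<close>
definition independent_sections :: "'a \<Rightarrow> 'a \<Rightarrow> nat \<Rightarrow> bool" where
  "independent_sections x y k \<longleftrightarrow> (\<exists>f.
     (\<forall>i<k. is_section (interval x y) (f i)) \<and>
     (\<forall>a v. (\<forall>z \<in> interval x y. (\<Sum>i<k. a i *\<^sub>R f i z) = v) \<longrightarrow> (\<forall>i<k. a i = (0 :: real))))"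

lemma independent_sectionsI:
  assumes "\<And>i. i < k \<Longrightarrow> is_section (interval x y) (f i)"
    "\<And>a v i. (\<And>z. z \<in> interval x y \<Longrightarrow> (\<Sum>i<k. a i *\<^sub>R f i z) = v) \<Longrightarrow> i < k \<Longrightarrow> a i = (0 :: real)"
  shows "independent_sections x y k"
  unfolding independent_sections_def
proof (intro exI[of _ f] conjI allI impI)
  fix a v i assume "\<forall>z \<in> interval x y. (\<Sum>i<k. a i *\<^sub>R f i z) = v" "i < k"
  then show "a i = 0" by (intro assms(2)[of a v]) auto
qed (rule assms(1))

context
  fixes x y s
  assumes s: "s \<in> S" and xy: "x \<preceq> y"
    and lx: "len x < len (x \<otimes> s)" and ly: "len (y \<otimes> s) < len y"
begin

lemma extend_family:
  fixes f :: "nat \<Rightarrow> 'a \<Rightarrow> 'a \<Rightarrow>\<^sub>0 real"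
  assumes "\<And>i. i < k \<Longrightarrow> is_section (interval x (y \<otimes> s)) (f i)"
  obtains F c where "\<forall>i<k. is_section (interval x y) (F i) \<and>
      (\<forall>z \<in> interval x (y \<otimes> s). F i z = f i z) \<and>
      (\<forall>z \<in> interval x y. F i (z \<otimes> s) = F i z + c i *\<^sub>R act z (simple_root s)) \<and>
      (x \<otimes> s \<preceq> y \<otimes> s \<or> c i = 0)"
proof -
  define Q where "Q i F c \<longleftrightarrow> is_section (interval x y) F \<and> (\<forall>z \<in> interval x (y \<otimes> s). F z = f i z) \<and>
    (\<forall>z \<in> interval x y. F (z \<otimes> s) = F z + c *\<^sub>R act z (simple_root s)) \<and>
    (x \<otimes> s \<preceq> y \<otimes> s \<or> c = 0)" for i F c
  have "\<exists>F c. Q i F c" if "i < k" for i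
    by (rule section_extend_ex[OF s xy lx ly assms[OF that]]) (unfold Q_def, blast)
  then have "\<exists>F c. \<forall>i<k. Q i (F i) (c i)" by metis
  then obtain F c where "\<forall>i<k. Q i (F i) (c i)" by blast
  then show thesis unfolding Q_def by (rule that)
qed

lemma independent_sections_extend:
  assumes "independent_sections x (y \<otimes> s) k"
  shows "independent_sections x y k"
proof -
  obtain f where sec: "\<forall>i<k. is_section (interval x (y \<otimes> s)) (f i)"
    and ind: "\<forall>a v. (\<forall>z \<in> interval x (y \<otimes> s). (\<Sum>i<k. a i *\<^sub>R f i z) = v) \<longrightarrow> (\<forall>i<k. a i = 0)"
    using assms unfolding independent_sections_def by (elim exE conjE)
  then have f: "\<And>i. i < k \<Longrightarrow> is_section (interval x (y \<otimes> s)) (f i)" by simp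
  obtain F where F: "\<And>i. i < k \<Longrightarrow> is_section (interval x y) (F i)"
    and ext: "\<And>i z. i < k \<Longrightarrow> z \<in> interval x (y \<otimes> s) \<Longrightarrow> F i z = f i z"
  proof -
    obtain F c where "\<forall>i<k. is_section (interval x y) (F i) \<and>
      (\<forall>z \<in> interval x (y \<otimes> s). F i z = f i z) \<and>
      (\<forall>z \<in> interval x y. F i (z \<otimes> s) = F i z + c i *\<^sub>R act z (simple_root s)) \<and>
      (x \<otimes> s \<preceq> y \<otimes> s \<or> c i = 0)"
      by (rule extend_family[OF f])
    then show thesis by (intro that[of F]) simp_all
  qed
  show ?thesis
  proof (rule independent_sectionsI[OF F])
    fix a v i assume const: "\<And>z. z \<in> interval x y \<Longrightarrow> (\<Sum>i<k. a i *\<^sub>R F i z) = v" and i: "i < k"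
    have "(\<Sum>i<k. a i *\<^sub>R f i z) = v" if "z \<in> interval x (y \<otimes> s)" for z
      using const[of z] ext[OF _ that] lower_interval_subset[OF s xy lx ly] that by auto
    then show "a i = 0" using ind[THEN spec[of _ a], THEN spec[of _ v]] i by blast
  qed
qed

text \<open>
  When \<open>x s\<close> is not below \<open>y s\<close>, a section that vanishes on the lower interval and has slope
  \<open>1\<close> is a new one.
\<close>
lemma independent_sections_new:
  assumes "independent_sections x (y \<otimes> s) k" and xys: "x \<preceq> y \<otimes> s" and no: "\<not> x \<otimes> s \<preceq> y \<otimes> s"
  shows "independent_sections x y (Suc k)"
proof -
  let ?A = "interval x (y \<otimes> s)"
  obtain f where sec: "\<forall>i<k. is_section ?A (f i)"
    and ind: "\<forall>a v. (\<forall>z \<in> ?A. (\<Sum>i<k. a i *\<^sub>R f i z) = v) \<longrightarrow> (\<forall>i<k. a i = 0)"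
    using assms(1) unfolding independent_sections_def by (elim exE conjE)
  then have f: "\<And>i. i < k \<Longrightarrow> is_section ?A (f i)" by simp
  obtain F where F: "\<And>i. i < k \<Longrightarrow> is_section (interval x y) (F i)"
    and ext: "\<And>i z. i < k \<Longrightarrow> z \<in> ?A \<Longrightarrow> F i z = f i z"
  proof -
    obtain F c where "\<forall>i<k. is_section (interval x y) (F i) \<and>
      (\<forall>z \<in> interval x (y \<otimes> s). F i z = f i z) \<and>
      (\<forall>z \<in> interval x y. F i (z \<otimes> s) = F i z + c i *\<^sub>R act z (simple_root s)) \<and>
      (x \<otimes> s \<preceq> y \<otimes> s \<or> c i = 0)"
      by (rule extend_family[OF f])
    then show thesis by (intro that[of F]) simp_all
  qed
  have none: "z \<otimes> s \<notin> ?A" if "z \<in> ?A" for z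
    using lifting_up[of x z s] that s no le_trans unfolding bruhat_interval_def by blast
  obtain N where N: "is_section (interval x y) N" "\<And>z. z \<in> ?A \<Longrightarrow> N z = 0"
    "\<And>z. z \<in> interval x y \<Longrightarrow> N (z \<otimes> s) = N z + 1 *\<^sub>R act z (simple_root s)"
    by (rule section_extend[OF s xy lx ly is_section_zero, of 1]) (use none in blast)+
  define G where "G = F(k := N)"
  have x: "x \<in> ?A" "x \<in> interval x y" using xys xy le_carrier unfolding bruhat_interval_def by auto
  have xs: "x \<otimes> s \<in> interval x y" using interval_stable[OF s xy lx ly] x by blast
  have split: "(\<Sum>i<Suc k. a i *\<^sub>R G i z) = (\<Sum>i<k. a i *\<^sub>R F i z) + a k *\<^sub>R N z" for a z
    by (simp add: G_def)
  show ?thesis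
  proof (rule independent_sectionsI[of "Suc k" _ _ G])
    show "is_section (interval x y) (G i)" if "i < Suc k" for i
      using that F N(1) by (auto simp: G_def less_Suc_eq)
    fix a v i assume const: "\<And>z. z \<in> interval x y \<Longrightarrow> (\<Sum>i<Suc k. a i *\<^sub>R G i z) = v" and i: "i < Suc k"
    have "(\<Sum>i<k. a i *\<^sub>R f i z) = v" if "z \<in> ?A" for z
      using const[of z] ext[OF _ that] N(2)[OF that] lower_interval_subset[OF s xy lx ly] that
      unfolding split by auto
    then have zero: "a j = 0" if "j < k" for j
      using ind[THEN spec[of _ a], THEN spec[of _ v]] that by blast
    then have "a k *\<^sub>R N x = v" "a k *\<^sub>R N (x \<otimes> s) = v"
      using const[OF x(2)] const[OF xs] unfolding split by simp_all
    then have "a k *\<^sub>R act x (simple_root s) = 0" using N(2)[OF x(1)] N(3)[OF x(2)] by simp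
    then have "a k = 0" using xy le_carrier by simp
    then show "a i = 0" using zero i by (auto simp: less_Suc_eq)
  qed
qed

text \<open>
  The upper interval: an extended section that is constant on it has slope \<open>0\<close>, so it is
  \<open>s\<close>-invariant, and every element of the lower interval or its \<open>s\<close>-translate lies in the upper
  interval.
\<close>
lemma independent_sections_upper:
  assumes "independent_sections x (y \<otimes> s) k"
  shows "independent_sections (x \<otimes> s) y k"
proof -
  let ?A = "interval x (y \<otimes> s)" and ?U = "interval (x \<otimes> s) y"
  have x: "x \<in> carrier W" and y: "y \<in> carrier W" using xy le_carrier by blast+
  obtain f where sec: "\<forall>i<k. is_section ?A (f i)"
    and ind: "\<forall>a v. (\<forall>z \<in> ?A. (\<Sum>i<k. a i *\<^sub>R f i z) = v) \<longrightarrow> (\<forall>i<k. a i = 0)"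
    using assms(1) unfolding independent_sections_def by (elim exE conjE)
  then have f: "\<And>i. i < k \<Longrightarrow> is_section ?A (f i)" by simp
  obtain F c where F: "\<And>i. i < k \<Longrightarrow> is_section (interval x y) (F i)"
    and ext: "\<And>i z. i < k \<Longrightarrow> z \<in> ?A \<Longrightarrow> F i z = f i z"
    and slope: "\<And>i z. i < k \<Longrightarrow> z \<in> interval x y \<Longrightarrow> F i (z \<otimes> s) = F i z + c i *\<^sub>R act z (simple_root s)"
    and c: "\<And>i. i < k \<Longrightarrow> x \<otimes> s \<preceq> y \<otimes> s \<or> c i = 0"
  proof -
    obtain F c where "\<forall>i<k. is_section (interval x y) (F i) \<and>
      (\<forall>z \<in> interval x (y \<otimes> s). F i z = f i z) \<and>
      (\<forall>z \<in> interval x y. F i (z \<otimes> s) = F i z + c i *\<^sub>R act z (simple_root s)) \<and>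
      (x \<otimes> s \<preceq> y \<otimes> s \<or> c i = 0)"
      by (rule extend_family[OF f])
    then show thesis by (intro that[of F c]) simp_all
  qed
  have sub: "?U \<subseteq> interval x y"
    using le_gen_up[OF x s lx] le_trans unfolding bruhat_interval_def by blast
  show ?thesis
  proof (rule independent_sectionsI)
    show "is_section ?U (F i)" if "i < k" for i using F[OF that] sub is_section_subset by blast
    fix a v i assume const: "\<And>z. z \<in> ?U \<Longrightarrow> (\<Sum>i<k. a i *\<^sub>R F i z) = v" and i: "i < k"
    define G where "G z = (\<Sum>i<k. a i *\<^sub>R F i z)" for z
    define C where "C = (\<Sum>i<k. a i * c i)"
    have G: "G (z \<otimes> s) = G z + C *\<^sub>R act z (simple_root s)" if "z \<in> interval x y" for z
      using slope[OF _ that]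
      by (simp add: G_def C_def scaleR_add_right sum.distrib scaleR_sum_left)
    have "C = 0"
    proof (cases "x \<otimes> s \<preceq> y \<otimes> s")
      case True
      have U: "y \<in> ?U" "y \<otimes> s \<in> ?U"
        using lift_right_descent[OF xy s ly] True le_gen_down[OF y s ly] y
        unfolding bruhat_interval_def by auto
      have "y \<otimes> s \<in> interval x y" using U sub by blast
      from G[OF this] have "C *\<^sub>R act (y \<otimes> s) (simple_root s) = 0"
        using const[OF U(1)] const[OF U(2)] y s by (simp add: G_def)
      then show ?thesis using y s by simp
    next
      case False
      then have "c i = 0" if "i < k" for i using c that by blast
      then show ?thesis by (simp add: C_def)
    qed
    then have inv: "G (z \<otimes> s) = G z" if "z \<in> interval x y" for z using G[OF that] by simp
    have "(\<Sum>i<k. a i *\<^sub>R f i z) = v" if z: "z \<in> ?A" for z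
    proof -
      have zB: "z \<in> interval x y" using z lower_interval_subset[OF s xy lx ly] by blast
      have "z \<in> ?U \<or> z \<otimes> s \<in> ?U"
        using lifting_up[of x z s] zB s interval_stable[OF s xy lx ly zB]
        unfolding bruhat_interval_def by blast
      then have "G z = v" using const inv[OF zB] unfolding G_def by metis
      then show ?thesis using ext[OF _ z] by (simp add: G_def)
    qed
    then show "a i = 0" using ind[THEN spec[of _ a], THEN spec[of _ v]] i by blast
  qed
qed

end

text \<open>
  The recursion of \<open>d\<close> for a right descent \<open>s\<close> of \<open>y\<close> is matched case by case by the lemmas above.
  The case \<open>x = y\<close> is separate because the truncated subtraction in the definition of \<open>d_coeff\<close>
  makes \<open>d x x = - 1\<close>.
\<close>
theorem d_independent_sections:
  assumes "x \<preceq> y"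
  shows "\<exists>k. independent_sections x y k \<and> (if x = y then k = 0 else int k = d x y)"
  using assms
proof (induction "len y" arbitrary: x y rule: less_induct)
  case less
  have x: "x \<in> carrier W" and y: "y \<in> carrier W" using less.prems le_carrier by blast+
  show ?case
  proof (cases "x = y")
    case True
    have "independent_sections x y 0" by (rule independent_sectionsI) auto
    then show ?thesis using True by auto
  next
    case False
    then have "y \<noteq> \<one>" using less.prems le_one by blast
    then obtain s where s: "s \<in> S" "len y = Suc (len (y \<otimes> s))" by (rule ex_right_descent[OF y])
    then have ly: "len (y \<otimes> s) < len y" by simp
    show ?thesis
    proof (cases rule: len_right_cases[OF x s(1)])
      case 1
      then have lx: "len x < len (x \<otimes> s)" by simp
      have xys: "x \<preceq> y \<otimes> s" by (rule lift_left_ascent[OF less.prems s(1) lx])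
      obtain k where k: "independent_sections x (y \<otimes> s) k"
        "if x = y \<otimes> s then k = 0 else int k = d x (y \<otimes> s)"
        using less.hyps[OF ly xys] by blast
      show ?thesis
      proof (cases "x \<otimes> s \<preceq> y \<otimes> s")
        case True
        have "x \<noteq> y \<otimes> s" using le_len[OF True] lx by auto
        then have "int k = d x y" using k(2) True d_ascent[OF x y s(1) ly lx xys] by simp
        then show ?thesis
          using independent_sections_extend[OF s(1) less.prems lx ly k(1)] False by auto
      next
        case no: False
        have "int (Suc k) = d x y"
        proof (cases "x = y \<otimes> s")
          case True
          then have "y = x \<otimes> s" using y s by simp
          then show ?thesis using k(2) True d_simple_edge[OF x s(1) lx] by simp
        next
          case False
          then show ?thesis using k(2) no d_ascent[OF x y s(1) ly lx xys] by simp
        qed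
        then show ?thesis
          using independent_sections_new[OF s(1) less.prems lx ly k(1) xys no] False
          by (intro exI[of _ "Suc k"]) simp
      qed
    next
      case 2
      let ?x = "x \<otimes> s"
      have lx: "len ?x < len (?x \<otimes> s)" using 2 x s by simp
      have "?x \<preceq> y \<otimes> s" using lift_both_descent[OF less.prems s(1)] 2 by simp
      then obtain k where k: "independent_sections ?x (y \<otimes> s) k"
        "if ?x = y \<otimes> s then k = 0 else int k = d ?x (y \<otimes> s)"
        using less.hyps[OF ly] by blast
      have "?x \<preceq> y" using \<open>?x \<preceq> y \<otimes> s\<close> le_gen_down[OF y s(1) ly] le_trans by blast
      then have "independent_sections x y k"
        using independent_sections_upper[OF s(1) _ lx ly k(1)] x s by simp
      moreover have "?x \<noteq> y \<otimes> s" using False x y s by (metis gen_cancel(1))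
      then have "int k = d x y" using k(2) d_descent[OF x y s(1) ly] 2 by simp
      ultimately show ?thesis using False by auto
    qed
  qed
qed


section \<open>Diamond generating sets\<close>

lemma bruhat_edgeE:
  assumes "{z, w} \<in> bruhat_edges W S x y"
  obtains r \<gamma> where "root_of r \<gamma>" "w = r \<otimes> z" "z \<in> interval x y" "w \<in> interval x y"
proof -
  obtain a b t where ab: "{z, w} = {a, b}" "a \<in> interval x y" "b \<in> interval x y"
    "t \<in> reflections W S" "b = a \<otimes> t"
    using assms unfolding bruhat_edges_def by blast
  have a: "a \<in> carrier W" using ab interval_carrier by blast
  have t: "t \<in> carrier W" using ab reflections_carrier by blast
  have "a = b \<otimes> t" using ab a t by (simp add: m_assoc)
  then have w: "w = z \<otimes> t" "z \<in> interval x y" "w \<in> interval x y"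
    using ab by (auto simp: doubleton_eq_iff)
  have z: "z \<in> carrier W" using w interval_carrier by blast
  obtain \<gamma> where "root_of (z \<otimes> t \<otimes> inv z) \<gamma>"
    using reflection_root[OF reflections_conj[OF ab(4) z]] .
  then show thesis by (rule that) (use right_edge[OF z t] w in simp_all)
qed

lemma step_edge:
  assumes "step u v" "u \<in> interval x y" "v \<in> interval x y"
  shows "{u, v} \<in> bruhat_edges W S x y"
  using assms unfolding bruhat_edges_def bruhat_step_def by blast

text \<open>
  The edges along which a section does not change form a diamond closed set: at the fourth vertex
  of a diamond, the change is a multiple of two roots of different reflections.
\<close>
lemma constant_edges_diamond_closed:
  assumes g: "is_section (interval x y) g"
  defines "E \<equiv> bruhat_edges W S x y"
  shows "diamond_closed E {e \<in> E. \<forall>p \<in> e. \<forall>q \<in> e. g p = g q}"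
proof -
  define C where "C = {e \<in> E. \<forall>p \<in> e. \<forall>q \<in> e. g p = g q}"
  have C: "{p, q} \<in> C \<longleftrightarrow> {p, q} \<in> E \<and> g p = g q" for p q by (auto simp: C_def)
  have "{c, d} \<in> C \<and> {d, a} \<in> C" if "is_diamond E a b c d" "{a, b} \<in> C" "{b, c} \<in> C" for a b c d
  proof -
    have E: "{c, d} \<in> E" "{d, a} \<in> E" and ac: "a \<noteq> c" using that unfolding is_diamond_def by simp_all
    have eq: "g a = g c" using that C by simp
    have "{a, d} \<in> E" using E(2) by (simp add: insert_commute)
    then obtain t \<beta> where t: "root_of t \<beta>" "d = t \<otimes> a" "a \<in> interval x y" "d \<in> interval x y"
      unfolding E_def by (rule bruhat_edgeE)
    obtain r \<gamma> where r: "root_of r \<gamma>" "d = r \<otimes> c" "c \<in> interval x y" "d \<in> interval x y"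
      using E(1) unfolding E_def by (rule bruhat_edgeE)
    have "r \<noteq> t"
    proof
      assume "r = t"
      then have "t \<otimes> c = t \<otimes> a" using t(2) r(2) by simp
      moreover have "a \<in> carrier W" "c \<in> carrier W" using t(3) r(3) interval_carrier by blast+
      ultimately show False using ac root_of_carrier[OF t(1)] by simp
    qed
    have "r \<otimes> c \<in> interval x y" "t \<otimes> a \<in> interval x y" using t r by simp_all
    then obtain e e' where "g (r \<otimes> c) = g c + e *\<^sub>R \<gamma>" "g (t \<otimes> a) = g a + e' *\<^sub>R \<beta>"
      using g r(1,3) t(1,3) unfolding is_section_def by blast
    then have e: "g d = g c + e *\<^sub>R \<gamma>" and e': "g d = g a + e' *\<^sub>R \<beta>"
      using r(2) t(2) by simp_all
    have "e = 0" using roots_independent(1)[OF r(1) t(1) \<open>r \<noteq> t\<close>, of e e'] e e' eq by simp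
    then have "g d = g c" using e by simp
    then show ?thesis using C E eq by simp
  qed
  moreover have "C \<subseteq> E" by (auto simp: C_def)
  ultimately show ?thesis unfolding diamond_closed_def C_def[symmetric] by blast
qed

lemma section_constant_of_generating:
  assumes g: "is_section (interval x y) g" and F: "diamond_generating (bruhat_edges W S x y) F"
    and const: "\<forall>e\<in>F. \<forall>p\<in>e. \<forall>q\<in>e. g p = g q"
    and z: "z \<in> interval x y"
  shows "g z = g x"
proof -
  let ?E = "bruhat_edges W S x y"
  let ?C = "{e \<in> ?E. \<forall>p \<in> e. \<forall>q \<in> e. g p = g q}"
  have "F \<subseteq> ?C" using F const unfolding diamond_generating_def by blast
  then have "diamond_closure ?E F \<subseteq> ?C"
    using constant_edges_diamond_closed[OF g] unfolding diamond_closure_def by blast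
  then have edges: "g p = g q" if "{p, q} \<in> ?E" for p q
    using F that unfolding diamond_generating_def by blast
  have "x \<preceq> z" "z \<preceq> y" using z unfolding bruhat_interval_def by auto
  then show ?thesis
  proof (induction rule: le_induct)
    case (step u v)
    have "u \<preceq> y" using step step_le le_trans by blast
    then have "u \<in> interval x y" "v \<in> interval x y"
      using step step_le le_trans unfolding bruhat_interval_def by blast+
    then have "g u = g v" using edges step_edge[OF step.hyps(2)] by blast
    then show ?case using step.IH \<open>u \<preceq> y\<close> by simp
  qed simp
qed

text \<open>
  Each edge of \<open>F\<close> imposes one linear condition on the coefficients of a combination of sections,
  because the change along this edge is a multiple of a fixed root.
\<close>
lemma independent_sections_le_card:
  assumes "independent_sections x y k" and F: "diamond_generating (bruhat_edges W S x y) F"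
    and fin: "finite F"
  shows "k \<le> card F"
proof (rule ccontr)
  assume "\<not> k \<le> card F"
  obtain f where sec: "\<forall>i<k. is_section (interval x y) (f i)"
    and ind: "\<forall>a v. (\<forall>z \<in> interval x y. (\<Sum>i<k. a i *\<^sub>R f i z) = v) \<longrightarrow> (\<forall>i<k. a i = 0)"
    using assms(1) unfolding independent_sections_def by (elim exE conjE)
  then have f: "\<And>i. i < k \<Longrightarrow> is_section (interval x y) (f i)" by simp
  define edge where "edge e \<gamma> z w \<longleftrightarrow> e = {z, w} \<and> (\<forall>i<k. \<exists>c. f i w = f i z + c *\<^sub>R \<gamma>)"
    for e \<gamma> z w
  have "\<exists>\<gamma> z w. edge e \<gamma> z w" if "e \<in> F" for e
  proof -
    have "e \<in> bruhat_edges W S x y" using F that unfolding diamond_generating_def by blast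
    then obtain z w where e: "e = {z, w}" "{z, w} \<in> bruhat_edges W S x y"
      unfolding bruhat_edges_def by blast
    obtain r \<gamma> where r: "root_of r \<gamma>" "w = r \<otimes> z" "z \<in> interval x y" "w \<in> interval x y"
      using bruhat_edgeE[OF e(2)] .
    have "\<exists>c. f i w = f i z + c *\<^sub>R \<gamma>" if "i < k" for i
      using f[OF that] r unfolding is_section_def by simp
    then show ?thesis using e(1) unfolding edge_def by blast
  qed
  then obtain \<gamma> z w where edges: "\<And>e. e \<in> F \<Longrightarrow> edge e (\<gamma> e) (z e) (w e)" by metis
  define m where "m i e = (SOME c. f i (w e) = f i (z e) + c *\<^sub>R \<gamma> e)" for i e
  have m: "f i (w e) = f i (z e) + m i e *\<^sub>R \<gamma> e" if "e \<in> F" "i < k" for e i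
    unfolding m_def by (rule someI_ex) (use edges[OF that(1)] that(2) in \<open>simp add: edge_def\<close>)
  have "card F < card {..<k}" using \<open>\<not> k \<le> card F\<close> by simp
  then obtain c where c: "\<forall>e\<in>F. (\<Sum>i<k. c i * m i e) = 0" and nz: "\<exists>i\<in>{..<k}. c i \<noteq> 0"
    using homogeneous_system_nontrivial[OF fin, of "{..<k}" m] by blast
  define g where "g u = (\<Sum>i<k. c i *\<^sub>R f i u)" for u
  have g: "is_section (interval x y) g"
    unfolding g_def[abs_def] by (rule is_section_sum) (rule f)
  have "g (w e) = g (z e)" if "e \<in> F" for e
  proof -
    have "g (w e) = (\<Sum>i<k. c i *\<^sub>R f i (z e) + (c i * m i e) *\<^sub>R \<gamma> e)"
      unfolding g_def by (rule sum.cong) (simp_all add: m[OF that] scaleR_add_right)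
    also have "\<dots> = g (z e) + (\<Sum>i<k. c i * m i e) *\<^sub>R \<gamma> e"
      by (simp add: g_def sum.distrib scaleR_sum_left)
    finally show ?thesis using c that by simp
  qed
  then have "\<forall>p \<in> {z e, w e}. \<forall>q \<in> {z e, w e}. g p = g q" if "e \<in> F" for e
    using that by simp
  moreover have "{z e, w e} = e" if "e \<in> F" for e using edges[OF that] unfolding edge_def by blast
  ultimately have "\<forall>e\<in>F. \<forall>p\<in>e. \<forall>q\<in>e. g p = g q" by metis
  then have "g u = g x" if "u \<in> interval x y" for u
    using section_constant_of_generating[OF g F _ that] by blast
  then have "c i = 0" if "i < k" for i
    using ind[THEN spec[of _ c], THEN spec[of _ "g x"]] that unfolding g_def by blast
  then show False using nz by blast
qed

lemma ex_minimal_generating: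
  assumes "y \<in> carrier W"
  obtains F where "diamond_generating (bruhat_edges W S x y) F" "finite F" "card F = g_min W S x y"
proof -
  let ?E = "bruhat_edges W S x y"
  have "diamond_closed ?E ?E" unfolding diamond_closed_def is_diamond_def by blast
  then have "diamond_generating ?E ?E"
    unfolding diamond_generating_def diamond_closure_def diamond_closed_def by blast
  moreover have "?E \<subseteq> Pow (interval x y)" unfolding bruhat_edges_def by blast
  then have "finite ?E" using finite_interval[OF assms] finite_subset by blast
  ultimately have "\<exists>n F. diamond_generating ?E F \<and> finite F \<and> card F = n" by blast
  from LeastI_ex[OF this] obtain F where "diamond_generating ?E F \<and> finite F \<and> card F = g_min W S x y"
    unfolding g_min_def by (elim exE)
  then show thesis using that by blast
qed

end

theorem proposition4p7:
  fixes W :: "('a, 'b) monoid_scheme" and S :: "'a set" and x y :: 'a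
  assumes "coxeter_system W S"
    and "bruhat_less W S x y"
  shows "d_coeff W S x y \<le> int (g_min W S x y)"
proof -
  interpret coxeter_system W S by (rule assms(1))
  have xy: "bruhat_le W S x y" "x \<noteq> y" using assms(2) unfolding bruhat_less_def by auto
  then obtain k where k: "independent_sections x y k" "int k = d_coeff W S x y"
    using d_independent_sections[OF xy(1)] by auto
  have "y \<in> carrier W" using xy(1) le_carrier by blast
  then obtain F where "diamond_generating (bruhat_edges W S x y) F" "finite F" "card F = g_min W S x y"
    by (rule ex_minimal_generating)
  then have "k \<le> g_min W S x y" using independent_sections_le_card[OF k(1), of F] by simp
  then show ?thesis using k(2) by linarith
qed

end
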